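(* Let $(\alpha,\beta)\in\mathcal U$, where $\mathcal U=\{(\alpha,\beta)\in(-1,\infty)^2: BC<0\}$, and put \[ \Delta_{n,k}=\gamma_{n+1}\theta_{n+1,k}^{(\alpha,\beta)}-\gamma_n\theta_{n,k}^{(\alpha,\beta)}. \] There exists $N=N(\alpha,\beta)$ such that, for every $n\geq N$, $\Delta_{n,1}$ has the same sign as $C$, whereas $\Delta_{n,n}$ has the same sign as $B$. In particular, \[ \Delta_{n,1}\Delta_{n,n}<0,\qquad n\geq N. \]
   Context: $P_n^{(\alpha,\beta)}$ denotes the Jacobi polynomial of degree $n$ (orthogonal on $(-1,1)$ with respect to the weight $(1-x)^\alpha(1+x)^\beta$). For $\alpha,\beta>-1$ its $n$ zeros are simple and lie in $(-1,1)$; they are written $\cos\theta_{n,k}^{(\alpha,\beta)}$, $1\le k\le n$, with $0<\theta_{n,1}^{(\alpha,\beta)}<\cdots<\theta_{n,n}^{(\alpha,\beta)}<\pi$. Notation: $\gamma_n=n+\rho$ with $\rho=\frac{\alpha+\beta+1}{2}$; $A=\frac{1-4\alpha^2}{16}$, $B=\frac{1-4\beta^2}{16}$, and $C=A+3B=\frac{1-\alpha^2-3\beta^2}{4}$. *)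

theory Defs
  imports "HOL-Analysis.Analysis"
begin

text \<open>
  Orthogonality determines the Jacobi polynomial only up to a nonzero constant factor, which is
  irrelevant for its zeros. It is fixed here by the usual normalisation
  \<open>P\<^sub>n(1) = binomial(n + \<alpha>, n)\<close>.
\<close>

definition is_jacobi_poly :: "real \<Rightarrow> real \<Rightarrow> nat \<Rightarrow> real poly \<Rightarrow> bool" where
  "is_jacobi_poly \<alpha> \<beta> n p \<longleftrightarrow>
     degree p = n \<and>
     (\<forall>q :: real poly. degree q < n \<longrightarrow>
        ((\<lambda>x. (1 - x) powr \<alpha> * (1 + x) powr \<beta> * (poly p x * poly q x)) has_integral 0) {-1<..<1}) \<and>
     poly p 1 = (\<alpha> + real n) gchoose n"

definition jacobi_poly :: "real \<Rightarrow> real \<Rightarrow> nat \<Rightarrow> real poly" where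
  "jacobi_poly \<alpha> \<beta> n = (THE p. is_jacobi_poly \<alpha> \<beta> n p)"

text \<open>
  For \<open>\<alpha>, \<beta> > -1\<close> the description above has exactly one solution, namely the terminating
  hypergeometric sum \<open>binomial(n + \<alpha>, n) \<cdot> \<^sub>2F\<^sub>1(-n, n + \<alpha> + \<beta> + 1; \<alpha> + 1; (1 - x)/2)\<close>. Its orthogonality
  is the Chu--Vandermonde identity applied to Beta integrals.
\<close>

context
  fixes \<alpha> \<beta> :: real
  assumes a: "\<alpha> > -1" and b: "\<beta> > -1"
begin

private definition W :: "real \<Rightarrow> real" where
  "W x = (1 - x) powr \<alpha> * (1 + x) powr \<beta>"

definition jacobi_explicit :: "nat \<Rightarrow> real poly" where
  "jacobi_explicit n = (\<Sum>k\<le>n. smult (((\<alpha> + n) gchoose n) * pochhammer (- real n) k * pochhammer (n + \<alpha> + \<beta> + 1) k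
                           / (fact k * pochhammer (\<alpha> + 1) k)) ([:1/2, -1/2:] ^ k))"

private lemma moment:
  "((\<lambda>x. W x * (((1 - x) / 2) ^ k * (1 + x) ^ m)) has_integral
      2 powr (\<alpha> + \<beta> + m + 1) * Beta (\<beta> + m + 1) (\<alpha> + k + 1)) {-1<..<1}"
proof -
  have "((\<lambda>t. t powr ((\<beta> + m + 1) - 1) * (1 - t) powr ((\<alpha> + k + 1) - 1)) has_integral
           Beta (\<beta> + m + 1) (\<alpha> + k + 1)) (cbox 0 1)"
    using has_integral_Beta_real[of "\<beta> + m + 1" "\<alpha> + k + 1"] a b by simp
  from has_integral_affinity'[OF this, of "1/2" "1/2"]
  have "((\<lambda>x. ((1 + x) / 2) powr (\<beta> + m) * (1 - (1 + x) / 2) powr (\<alpha> + k)) has_integral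
           2 * Beta (\<beta> + m + 1) (\<alpha> + k + 1)) {-1..1}"
    by (simp add: add_divide_distrib add.commute)
  from has_integral_mult_right[OF this, of "2 powr (\<alpha> + \<beta> + m)"]
  have "((\<lambda>x. 2 powr (\<alpha> + \<beta> + m) * (((1 + x) / 2) powr (\<beta> + m) * (1 - (1 + x) / 2) powr (\<alpha> + k)))
          has_integral 2 powr (\<alpha> + \<beta> + m) * (2 * Beta (\<beta> + m + 1) (\<alpha> + k + 1))) {-1<..<1}"
    by (simp add: has_integral_Icc_iff_Ioo)
  moreover have "2 powr (\<alpha> + \<beta> + m) * (((1 + x) / 2) powr (\<beta> + m) * (1 - (1 + x) / 2) powr (\<alpha> + k))
      = W x * (((1 - x) / 2) ^ k * (1 + x) ^ m)" if "x \<in> {-1<..<1}" for x :: real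
  proof -
    have e: "1 - (1 + x) / 2 = (1 - x) / 2"
      by (simp add: field_simps)
    have p: "1 + x > 0" "1 - x > 0"
      using that by auto
    have 1: "((1 + x) / 2) powr (\<beta> + m) = (1 + x) powr \<beta> * (1 + x) ^ m / (2 powr \<beta> * 2 ^ m)"
      using p by (simp add: powr_divide powr_add powr_realpow)
    have 2: "((1 - x) / 2) powr (\<alpha> + k) = (1 - x) powr \<alpha> / 2 powr \<alpha> * ((1 - x) / 2) ^ k"
      using p by (simp add: powr_divide powr_add powr_realpow power_divide)
    show ?thesis
      unfolding e 1 2 W_def by (simp add: powr_add powr_realpow)
  qed
  ultimately have "((\<lambda>x. W x * (((1 - x) / 2) ^ k * (1 + x) ^ m)) has_integral
      2 powr (\<alpha> + \<beta> + m) * (2 * Beta (\<beta> + m + 1) (\<alpha> + k + 1))) {-1<..<1}"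
    by (rule has_integral_eq[rotated])
  then show ?thesis
    by (simp add: powr_add mult_ac)
qed

lemma poly_jacobi_explicit:
  "poly (jacobi_explicit n) x = (\<Sum>k\<le>n. ((\<alpha> + n) gchoose n) * pochhammer (- real n) k * pochhammer (n + \<alpha> + \<beta> + 1) k
                           / (fact k * pochhammer (\<alpha> + 1) k) * ((1 - x) / 2) ^ k)"
proof -
  have "poly [:1/2, -1/2:] x = (1 - x) / 2"
    by (simp add: field_simps)
  then show ?thesis
    by (simp only: jacobi_explicit_def poly_sum poly_smult poly_power)
qed

private lemma J_moment:
  assumes "m < n"
  shows "((\<lambda>x. W x * (poly (jacobi_explicit n) x * (1 + x) ^ m)) has_integral 0) {-1<..<1}"
proof -
  define c where "c k = ((\<alpha> + n) gchoose n) * pochhammer (- real n) k * pochhammer (n + \<alpha> + \<beta> + 1) k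
                           / (fact k * pochhammer (\<alpha> + 1) k)" for k
  define M where "M k = 2 powr (\<alpha> + \<beta> + m + 1) * Beta (\<beta> + m + 1) (\<alpha> + k + 1)" for k :: nat
  have "((\<lambda>x. \<Sum>k\<le>n. c k * (W x * (((1 - x) / 2) ^ k * (1 + x) ^ m))) has_integral
          (\<Sum>k\<le>n. c k * M k)) {-1<..<1}"
    unfolding M_def by (intro has_integral_sum has_integral_mult_right moment) auto
  also have "(\<lambda>x. \<Sum>k\<le>n. c k * (W x * (((1 - x) / 2) ^ k * (1 + x) ^ m)))
               = (\<lambda>x. W x * (poly (jacobi_explicit n) x * (1 + x) ^ m))"
    unfolding poly_jacobi_explicit c_def[symmetric]
    by (simp add: sum_distrib_left sum_distrib_right mult_ac)
  also have "(\<Sum>k\<le>n. c k * M k) = 0"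
  proof -
    define s where "s = \<alpha> + \<beta> + m + 2"
    have s: "s > 0" using a b by (simp add: s_def)
    define K where "K = ((\<alpha> + n) gchoose n) * 2 powr (\<alpha> + \<beta> + m + 1)
                          * Gamma (\<beta> + m + 1) * Gamma (\<alpha> + 1) / Gamma s"
    have nonpos: "z \<notin> \<int>\<^sub>\<le>\<^sub>0" if "z > 0" for z :: real
      using that nonpos_Ints_nonpos by force
    have "c k * M k = K * (pochhammer (n + \<alpha> + \<beta> + 1) k * pochhammer (- real n) k / (fact k * pochhammer s k))" for k
    proof -
      have g1: "Gamma (\<alpha> + k + 1) = pochhammer (\<alpha> + 1) k * Gamma (\<alpha> + 1)"
      proof -
        have "\<alpha> + 1 > 0" using a by simp
        note g = nonpos[OF this] Gamma_real_pos[OF this]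
        have "pochhammer (\<alpha> + 1) k = Gamma (\<alpha> + 1 + k) / Gamma (\<alpha> + 1)"
          using pochhammer_Gamma[OF g(1)] by simp
        then have "Gamma (\<alpha> + 1 + k) = pochhammer (\<alpha> + 1) k * Gamma (\<alpha> + 1)"
          using g(2) by (simp add: nonzero_eq_divide_eq)
        moreover have "\<alpha> + 1 + k = \<alpha> + k + 1" by simp
        ultimately show ?thesis by metis
      qed
      have g2: "Gamma (\<beta> + m + 1 + (\<alpha> + k + 1)) = pochhammer s k * Gamma s"
      proof -
        note g = nonpos[OF s] Gamma_real_pos[OF s]
        have "pochhammer s k = Gamma (s + k) / Gamma s"
          using pochhammer_Gamma[OF g(1)] by simp
        then have "Gamma (s + k) = pochhammer s k * Gamma s"
          using g(2) by (simp add: nonzero_eq_divide_eq)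
        moreover have "s + k = \<beta> + m + 1 + (\<alpha> + k + 1)" by (simp add: s_def)
        ultimately show ?thesis by metis
      qed
      have "pochhammer (\<alpha> + 1) k > 0" "pochhammer s k > 0" "Gamma s > 0"
        using a s by (auto intro: pochhammer_pos)
      then show ?thesis
        unfolding c_def M_def K_def Beta_def g1 g2 by (simp add: field_simps)
    qed
    then have "(\<Sum>k\<le>n. c k * M k) = K * (\<Sum>k\<le>n. pochhammer (n + \<alpha> + \<beta> + 1) k * pochhammer (- real n) k / (fact k * pochhammer s k))"
      by (simp add: sum_distrib_left)
    also have "(\<Sum>k\<le>n. pochhammer (n + \<alpha> + \<beta> + 1) k * pochhammer (- real n) k / (fact k * pochhammer s k))
        = pochhammer (s - (n + \<alpha> + \<beta> + 1)) n / pochhammer s n"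
      using Vandermonde_pochhammer[of n s "n + \<alpha> + \<beta> + 1"] s
      by (auto simp: atLeast0AtMost)
    also have "s - (n + \<alpha> + \<beta> + 1) = - real (n - 1 - m)"
      using assms by (simp add: s_def of_nat_diff)
    also have "pochhammer (- real (n - 1 - m)) n = 0"
      using assms by (intro pochhammer_of_nat_eq_0_lemma) simp
    finally show ?thesis by simp
  qed
  finally show ?thesis .
qed

private lemma gchoose_pos: "((\<alpha> + real n) gchoose n) > 0"
  unfolding gbinomial_pochhammer' using a by (intro divide_pos_pos pochhammer_pos) auto

lemma degree_jacobi_explicit: "degree (jacobi_explicit n) = n"
proof (rule antisym)
  define L where "L = [:1/2, -1/2 :: real:]"
  note J = jacobi_explicit_def[of n, folded L_def]
  have d: "degree (L ^ k) = k" for k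
    by (subst degree_power_eq) (auto simp: L_def)
  show "degree (jacobi_explicit n) \<le> n"
    unfolding J by (intro degree_sum_le) (auto intro!: order.trans[OF degree_smult_le] simp: d simp del: degree_smult_eq)
  have "coeff (L ^ k) n = (if k = n then (-1/2) ^ n else 0)" if "k \<le> n" for k
  proof (cases "k = n")
    case True
    have "coeff (L ^ n) n = lead_coeff (L ^ n)"
      by (simp add: d)
    also have "\<dots> = (-1/2) ^ n" by (subst lead_coeff_power) (simp add: L_def)
    finally show ?thesis using True by simp
  next
    case False
    with that show ?thesis by (simp add: coeff_eq_0 d)
  qed
  then have "coeff (jacobi_explicit n) n = (\<Sum>k\<le>n. if k = n then ((\<alpha> + n) gchoose n) * pochhammer (- real n) k * pochhammer (n + \<alpha> + \<beta> + 1) k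
                           / (fact k * pochhammer (\<alpha> + 1) k) * (-1/2) ^ n else 0)"
    unfolding J coeff_sum by (intro sum.cong) auto
  also have "\<dots> = ((\<alpha> + n) gchoose n) * pochhammer (- real n) n * pochhammer (n + \<alpha> + \<beta> + 1) n
                           / (fact n * pochhammer (\<alpha> + 1) n) * (-1/2) ^ n"
    by simp
  also have "\<dots> \<noteq> 0"
  proof -
    have "pochhammer (n + \<alpha> + \<beta> + 1) n \<noteq> 0"
    proof (cases "n = 0")
      case False
      then have "n + \<alpha> + \<beta> + 1 > 0" using a b by simp
      from pochhammer_pos[OF this, of n] show ?thesis by simp
    qed simp
    moreover have "pochhammer (\<alpha> + 1) n \<noteq> 0"
      using a pochhammer_pos[of "\<alpha> + 1" n] by simp
    moreover have "pochhammer (- real n) n \<noteq> 0"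
      by (rule pochhammer_of_nat_eq_0_lemma') simp
    ultimately show ?thesis using gchoose_pos[of n] by simp
  qed
  finally show "n \<le> degree (jacobi_explicit n)" by (rule le_degree)
qed

lemma is_jacobi_poly_explicit: "is_jacobi_poly \<alpha> \<beta> n (jacobi_explicit n)"
  unfolding is_jacobi_poly_def
proof (intro conjI allI impI)
  show "degree (jacobi_explicit n) = n" by (rule degree_jacobi_explicit)
  show "poly (jacobi_explicit n) 1 = (\<alpha> + real n) gchoose n"
  proof -
    have "(\<Sum>k\<le>n. f k * 0 ^ k) = f 0" for f :: "nat \<Rightarrow> real"
      by (induction n) auto
    then show ?thesis by (simp add: poly_jacobi_explicit)
  qed
next
  fix q :: "real poly" assume q: "degree q < n"
  define r where "r = pcompose q [:-1, 1:]"
  have r: "poly q x = (\<Sum>i\<le>degree r. coeff r i * (1 + x) ^ i)" for x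
  proof -
    have "poly q x = poly r (1 + x)" by (simp add: r_def poly_pcompose)
    then show ?thesis by (simp add: poly_altdef)
  qed
  have "degree r < n" using q by (simp add: r_def degree_pcompose)
  then have "((\<lambda>x. \<Sum>i\<le>degree r. coeff r i * (W x * (poly (jacobi_explicit n) x * (1 + x) ^ i))) has_integral
               (\<Sum>i\<le>degree r. coeff r i * 0)) {-1<..<1}"
    by (intro has_integral_sum has_integral_mult_right J_moment) auto
  also have "(\<lambda>x. \<Sum>i\<le>degree r. coeff r i * (W x * (poly (jacobi_explicit n) x * (1 + x) ^ i)))
      = (\<lambda>x. (1 - x) powr \<alpha> * (1 + x) powr \<beta> * (poly (jacobi_explicit n) x * poly q x))"
    by (simp add: r W_def sum_distrib_left sum_distrib_right mult_ac)
  finally show "((\<lambda>x. (1 - x) powr \<alpha> * (1 + x) powr \<beta> * (poly (jacobi_explicit n) x * poly q x)) has_integral 0) {-1<..<1}"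
    by simp
qed

lemma is_jacobi_poly_unique:
  assumes "is_jacobi_poly \<alpha> \<beta> n p" "is_jacobi_poly \<alpha> \<beta> n p'"
  shows "p = p'"
proof (cases "n = 0")
  case True
  with assms have "degree p = 0" "degree p' = 0"
    by (simp_all add: is_jacobi_poly_def)
  then obtain u v where "p = [:u:]" "p' = [:v:]"
    by (elim degree_eq_zeroE)
  with assms show ?thesis by (simp add: is_jacobi_poly_def)
next
  case False
  have p: "degree p = n" "degree p' = n" "poly p 1 > 0" "poly p 1 = poly p' 1"
    using assms gchoose_pos[of n] by (auto simp: is_jacobi_poly_def)
  define c where "c = lead_coeff p / lead_coeff p'"
  define r where "r = p - smult c p'"
  have nz: "lead_coeff p' \<noteq> 0" using p(2) False by auto
  have "degree r < n"
  proof (rule degree_lessI)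
    show "r \<noteq> 0 \<or> 0 < n" using False by simp
    show "\<forall>k\<ge>n. coeff r k = 0"
    proof (intro allI impI)
      fix k assume "n \<le> k"
      then show "coeff r k = 0"
        using nz p by (cases "k = n") (auto simp: r_def c_def coeff_eq_0)
    qed
  qed
  then have "((\<lambda>x. W x * (poly p x * poly r x) - c * (W x * (poly p' x * poly r x)))
               has_integral 0 - c * 0) {-1<..<1}"
    using assms unfolding is_jacobi_poly_def W_def
    by (intro has_integral_diff has_integral_mult_right) auto
  then have I: "((\<lambda>x. W x * (poly r x)\<^sup>2) has_integral 0) {-1<..<1}"
    by (simp add: r_def power2_eq_square algebra_simps)
  have "poly r x = 0" if x: "x \<in> {-1<..<1}" for x
  proof -
    obtain u v where uv: "-1 < u" "u < x" "x < v" "v < 1"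
      using x dense[of "-1" x] dense[of x 1] by auto
    have int: "(\<lambda>x. W x * (poly r x)\<^sup>2) integrable_on {u..v}"
      unfolding W_def using uv by (intro integrable_continuous_real continuous_intros) auto
    have "integral {u..v} (\<lambda>x. W x * (poly r x)\<^sup>2) \<le> integral {-1<..<1} (\<lambda>x. W x * (poly r x)\<^sup>2)"
    proof (rule integral_subset_le)
      show "{u..v} \<subseteq> {-1<..<1}" using uv by auto
      show "(\<lambda>x. W x * (poly r x)\<^sup>2) integrable_on {-1<..<1}" using I by blast
    qed (use int in \<open>auto simp: W_def\<close>)
    moreover have "integral {u..v} (\<lambda>x. W x * (poly r x)\<^sup>2) \<ge> 0"
      by (intro integral_nonneg int) (auto simp: W_def)
    moreover have "integral {-1<..<1} (\<lambda>x. W x * (poly r x)\<^sup>2) = 0"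
      using I by (rule integral_unique)
    ultimately have "((\<lambda>x. W x * (poly r x)\<^sup>2) has_integral 0) (cbox u v)"
      using int by (simp add: has_integral_iff)
    moreover have "continuous_on (cbox u v) (\<lambda>x. W x * (poly r x)\<^sup>2)"
      unfolding W_def using uv by (intro continuous_intros) auto
    ultimately have "W x * (poly r x)\<^sup>2 = 0"
      using uv by (intro has_integral_0_cbox_imp_0[of u v "\<lambda>x. W x * (poly r x)\<^sup>2"]) (auto simp: W_def)
    then show ?thesis using x by (auto simp: W_def)
  qed
  then have "{-1<..<1} \<subseteq> {x. poly r x = 0}" by auto
  moreover have "infinite {-1<..<1 :: real}" by (rule infinite_Ioo) simp
  ultimately have "infinite {x. poly r x = 0}" by (rule infinite_super)
  then have "r = 0" using poly_roots_finite[of r] by auto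
  then have pc: "p = smult c p'" by (simp add: r_def)
  have "poly p 1 = c * poly p' 1" by (simp add: pc)
  with p have "c = 1" by simp
  with pc show ?thesis by simp
qed

lemma jacobi_poly_ex1: "\<exists>!p. is_jacobi_poly \<alpha> \<beta> n p"
  using is_jacobi_poly_explicit is_jacobi_poly_unique by blast

lemma jacobi_poly_eq_explicit: "jacobi_poly \<alpha> \<beta> n = jacobi_explicit n"
  unfolding jacobi_poly_def
  by (intro the_equality is_jacobi_poly_explicit) (rule is_jacobi_poly_unique[OF _ is_jacobi_poly_explicit])

end

lemma is_jacobi_poly_jacobi_poly:
  assumes "\<alpha> > -1" "\<beta> > -1"
  shows "is_jacobi_poly \<alpha> \<beta> n (jacobi_poly \<alpha> \<beta> n)"
  unfolding jacobi_poly_def by (rule theI'[OF jacobi_poly_ex1[OF assms]])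

text \<open>
  The list below is strictly increasing and is indexed from 0. For \<open>\<alpha>, \<beta> > -1\<close> all zeros of
  \<open>jacobi_poly \<alpha> \<beta> n\<close> are simple and lie in \<open>(-1, 1)\<close>, so the list has length \<open>n\<close> and
  \<open>jacobi_theta \<alpha> \<beta> n k\<close> is the intended angle for \<open>1 \<le> k \<le> n\<close> (and unspecified otherwise).
\<close>

definition jacobi_theta :: "real \<Rightarrow> real \<Rightarrow> nat \<Rightarrow> nat \<Rightarrow> real" where
  "jacobi_theta \<alpha> \<beta> n k =
     sorted_list_of_set {\<theta>. 0 < \<theta> \<and> \<theta> < pi \<and> poly (jacobi_poly \<alpha> \<beta> n) (cos \<theta>) = 0} ! (k - 1)"

definition jacobi_rho :: "real \<Rightarrow> real \<Rightarrow> real" where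
  "jacobi_rho \<alpha> \<beta> = (\<alpha> + \<beta> + 1) / 2"

definition jacobi_gamma :: "real \<Rightarrow> real \<Rightarrow> nat \<Rightarrow> real" where
  "jacobi_gamma \<alpha> \<beta> n = real n + jacobi_rho \<alpha> \<beta>"

definition jacobi_A :: "real \<Rightarrow> real" where
  "jacobi_A \<alpha> = (1 - 4 * \<alpha>\<^sup>2) / 16"

definition jacobi_B :: "real \<Rightarrow> real" where
  "jacobi_B \<beta> = (1 - 4 * \<beta>\<^sup>2) / 16"

definition jacobi_C :: "real \<Rightarrow> real \<Rightarrow> real" where
  "jacobi_C \<alpha> \<beta> = jacobi_A \<alpha> + 3 * jacobi_B \<beta>"

definition jacobi_U :: "(real \<times> real) set" where
  "jacobi_U = {(\<alpha>, \<beta>). \<alpha> > -1 \<and> \<beta> > -1 \<and> jacobi_B \<beta> * jacobi_C \<alpha> \<beta> < 0}"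

definition jacobi_Delta :: "real \<Rightarrow> real \<Rightarrow> nat \<Rightarrow> nat \<Rightarrow> real" where
  "jacobi_Delta \<alpha> \<beta> n k =
     jacobi_gamma \<alpha> \<beta> (n + 1) * jacobi_theta \<alpha> \<beta> (n + 1) k
     - jacobi_gamma \<alpha> \<beta> n * jacobi_theta \<alpha> \<beta> n k"

end

theory Submission
  imports Defs "HOL-Real_Asymp.Real_Asymp"
begin

text \<open>
  The substitution \<open>u(\<theta>) = sin(\<theta>/2)\<^sup>a cos(\<theta>/2)\<^sup>b P\<^sub>n(cos \<theta>)\<close> with \<open>a = \<alpha> + 1/2\<close>, \<open>b = \<beta> + 1/2\<close>
  removes the first-order term of the Jacobi equation, and \<open>x = \<gamma>\<^sub>n \<theta>\<close> normalises its frequency: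
  \<open>v(x) = u(x / \<gamma>\<^sub>n)\<close> satisfies

    \<open>v'' + (1 + (4 A + H(x / \<gamma>\<^sub>n)) / x\<^sup>2) v = 0\<close>, where
    \<open>H(\<theta>) = A (\<theta>\<^sup>2 / sin\<^sup>2(\<theta>/2) - 4) + B \<theta>\<^sup>2 / cos\<^sup>2(\<theta>/2)\<close>.

  The degree enters only through the argument of \<open>H\<close>. Since \<open>H(\<theta>) = (C/3) \<theta>\<^sup>2 + O(\<theta>\<^sup>4)\<close>, the
  function \<open>H\<close> is strictly monotone near \<open>0\<close> in the direction given by the sign of \<open>C\<close>. So no
  asymptotic expansion of the zeros in terms of Bessel zeros is needed; everything follows by
  comparing two equations.

  \<^item> The rescaled first zero \<open>\<gamma>\<^sub>n \<theta>\<^sub>n\<^sub>,\<^sub>1\<close> is bounded in \<open>n\<close> (\<open>scaled_first_zero_bounded\<close>), so that only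
    small arguments of \<open>H\<close> matter. On that range, passing from \<open>n\<close> to \<open>n + 1\<close> lowers the potential
    if \<open>C > 0\<close> and raises it if \<open>C < 0\<close>, and by Sturm comparison from the singular endpoint \<open>0\<close>
    the first zero moves right or left accordingly (\<open>sgn_scaled_first_zero_diff\<close>). This is the
    sign of \<open>\<Delta>\<^sub>n\<^sub>,\<^sub>1\<close>.

  \<^item> For bounded \<open>x\<close> and large \<open>n\<close> the potential lies above or below \<open>1\<close> according to the sign of
    \<open>A\<close>. Comparison with \<open>sin(x - y)\<close>, where \<open>y\<close> is the first zero, shows that the gap between the
    first two rescaled zeros is smaller or larger than \<open>\<pi>\<close> accordingly
    (\<open>sgn_pi_minus_scaled_zero_gap\<close>).

  The reflection \<open>\<theta> \<mapsto> \<pi> - \<theta>\<close> swaps \<open>\<alpha>\<close> and \<open>\<beta>\<close> and turns the zeros \<open>\<theta>\<^sub>n\<^sub>,\<^sub>n\<close> and \<open>\<theta>\<^sub>n\<^sub>+\<^sub>1\<^sub>,\<^sub>n\<close> into the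
  first zero of degree \<open>n\<close> and the \<^emph>\<open>second\<close> zero of degree \<open>n + 1\<close>. With \<open>s\<^sub>k(n)\<close> the \<open>k\<close>-th
  rescaled zero for the swapped parameters,

    \<open>\<Delta>\<^sub>n\<^sub>,\<^sub>n = [\<pi> - (s\<^sub>2(n + 1) - s\<^sub>1(n + 1))] + [s\<^sub>1(n) - s\<^sub>1(n + 1)]\<close>.

  The first bracket has the sign of \<open>B\<close>. The second has the sign opposite to that of the swapped
  constant \<open>B + 3A\<close>. Since \<open>BC < 0\<close> forces \<open>A\<close> to have the sign opposite to \<open>B\<close> and
  \<open>\<bar>A\<bar> > 3 \<bar>B\<bar>\<close>, that constant has the sign of \<open>A\<close>, so both brackets have the sign of \<open>B\<close>.
\<close>

section \<open>Sturm comparison on an interval with a singular left endpoint\<close>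

text \<open>
  The Wronskian \<open>v\<^sub>1 v\<^sub>2' - v\<^sub>1' v\<^sub>2\<close> has derivative \<open>(q\<^sub>1 - q\<^sub>2) v\<^sub>1 v\<^sub>2 > 0\<close> and starts nonnegative, so it is
  positive at \<open>b\<close>; but if \<open>v\<^sub>2\<close> vanished at \<open>b\<close>, coming from positive values, it would be
  \<open>v\<^sub>1(b) v\<^sub>2'(b) \<le> 0\<close> there. The solutions are controlled at \<open>a\<close> only through the limit of the Wronskian,
  because the comparison is needed at a singular point of both equations as well as at ordinary points.
\<close>

lemma sturm_comparison:
  fixes v1 v1' v2 v2' q1 q2 :: "real \<Rightarrow> real"
  assumes "a < b"
    and v1: "\<And>x. a < x \<Longrightarrow> x \<le> b \<Longrightarrow> (v1 has_real_derivative v1' x) (at x)"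
            "\<And>x. a < x \<Longrightarrow> x \<le> b \<Longrightarrow> (v1' has_real_derivative - q1 x * v1 x) (at x)"
    and v2: "\<And>x. a < x \<Longrightarrow> x \<le> b \<Longrightarrow> (v2 has_real_derivative v2' x) (at x)"
            "\<And>x. a < x \<Longrightarrow> x \<le> b \<Longrightarrow> (v2' has_real_derivative - q2 x * v2 x) (at x)"
    and q: "\<And>x. a < x \<Longrightarrow> x < b \<Longrightarrow> q2 x < q1 x"
    and pos: "\<And>x. a < x \<Longrightarrow> x < b \<Longrightarrow> 0 < v1 x" "\<And>x. a < x \<Longrightarrow> x < b \<Longrightarrow> 0 < v2 x"
    and lim: "((\<lambda>x. v1 x * v2' x - v1' x * v2 x) \<longlongrightarrow> L) (at_right a)" "0 \<le> L"
  shows "v2 b \<noteq> 0"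
proof
  assume zero: "v2 b = 0"
  define w where "w x = v1 x * v2' x - v1' x * v2 x" for x
  have dw: "(w has_real_derivative (q1 x - q2 x) * (v1 x * v2 x)) (at x)" if "a < x" "x \<le> b" for x
    unfolding w_def
    by (rule derivative_eq_intros v1[OF that] v2[OF that] refl | simp add: algebra_simps)+
  have mono: "w x < w y" if "a < x" "x < y" "y \<le> b" for x y
  proof (rule DERIV_pos_imp_increasing_open[OF \<open>x < y\<close>])
    fix z assume z: "x < z" "z < y"
    then show "\<exists>d. DERIV w z :> d \<and> d > 0"
      using that dw[of z] q[of z] pos[of z] by (intro exI[of _ "(q1 z - q2 z) * (v1 z * v2 z)"]) auto
  next
    show "continuous_on {x..y} w"
      using that by (intro continuous_at_imp_continuous_on ballI DERIV_isCont[OF dw]) auto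
  qed
  define c where "c = (a + b) / 2"
  have c: "a < c" "c < b" using \<open>a < b\<close> by (auto simp: c_def)
  have "L \<le> w c"
  proof (rule tendsto_upperbound[OF lim(1)])
    show "\<forall>\<^sub>F x in at_right a. v1 x * v2' x - v1' x * v2 x \<le> w c"
      using eventually_at_right_less[of a] eventually_at_right_real[OF c(1)]
    proof eventually_elim
      case (elim x)
      with mono[of x c] c show ?case by (auto simp: w_def)
    qed
  qed simp
  with mono[of c b] c lim(2) have wb: "w b > 0" by auto
  have v1b: "v1 b \<ge> 0"
  proof (rule tendsto_lowerbound)
    show "(v1 \<longlongrightarrow> v1 b) (at_left b)"
      using DERIV_isCont[OF v1(1)[of b]] \<open>a < b\<close>
      by (auto simp: isCont_def intro: filterlim_mono at_le)
    show "\<forall>\<^sub>F x in at_left b. 0 \<le> v1 x"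
      using eventually_at_left_real[OF \<open>a < b\<close>] by eventually_elim (auto intro: less_imp_le pos)
  qed simp
  have "v2' b \<le> 0"
  proof (rule ccontr)
    assume "\<not> v2' b \<le> 0"
    then have "v2' b > 0" by simp
    from DERIV_pos_inc_left[OF v2(1)[of b] this] \<open>a < b\<close>
    obtain d where d: "d > 0" "\<And>h. 0 < h \<Longrightarrow> h < d \<Longrightarrow> v2 (b - h) < v2 b" by auto
    define h where "h = min (d / 2) ((b - a) / 2)"
    have "h > 0" "h < d" "a < b - h" "b - h < b" using d \<open>a < b\<close> by (auto simp: h_def min_def field_simps)
    with d(2)[of h] pos(2)[of "b - h"] zero show False by auto
  qed
  then have "w b \<le> 0" using v1b zero by (simp add: w_def mult_nonneg_nonpos)
  with wb show False by simp
qed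

section \<open>Zeros of Jacobi polynomials\<close>

lemma add_gchoose_pos: "\<alpha> > - 1 \<Longrightarrow> ((\<alpha> + real n) gchoose n) > 0"
  unfolding gbinomial_pochhammer' by (intro divide_pos_pos pochhammer_pos) auto

lemma poly_one_signed_on_interval:
  fixes p :: "real poly"
  assumes "\<And>x. a < x \<Longrightarrow> x < b \<Longrightarrow> poly p x \<noteq> 0"
  shows "(\<forall>x. a < x \<and> x < b \<longrightarrow> poly p x \<ge> 0) \<or> (\<forall>x. a < x \<and> x < b \<longrightarrow> poly p x \<le> 0)"
proof (rule ccontr)
  assume "\<not> ?thesis"
  then obtain x y where xy: "a < x" "x < b" "a < y" "y < b" "poly p x < 0" "poly p y > 0"
    by (auto simp: not_le)
  then have "x \<noteq> y" by auto
  then show False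
    using poly_IVT_pos[of x y p] poly_IVT_neg[of y x p] xy assms
    by (metis less_trans linorder_neqE)
qed

text \<open>
  The set \<open>S\<close> consists of the roots of odd multiplicity. Building it by splitting off one root at
  a time and toggling its membership avoids any mention of multiplicities.
\<close>

lemma poly_fix_sign_changes:
  fixes p :: "real poly"
  assumes "p \<noteq> 0"
  shows "\<exists>S \<subseteq> {x. a < x \<and> x < b \<and> poly p x = 0}.
           (\<forall>x. a < x \<and> x < b \<longrightarrow> poly p x * (\<Prod>r\<in>S. x - r) \<ge> 0) \<or>
           (\<forall>x. a < x \<and> x < b \<longrightarrow> poly p x * (\<Prod>r\<in>S. x - r) \<le> 0)"
  using assms
proof (induction "degree p" arbitrary: p rule: less_induct)
  case less
  show ?case
  proof (cases "\<exists>r. a < r \<and> r < b \<and> poly p r = 0")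
    case False
    then show ?thesis
      using poly_one_signed_on_interval[of a b p] by (intro exI[of _ "{}"]) auto
  next
    case True
    then obtain r where r: "a < r" "r < b" "poly p r = 0" by blast
    then obtain p' where p': "p = [:-r, 1:] * p'" by (auto simp: poly_eq_0_iff_dvd elim: dvdE)
    with less.prems have "p' \<noteq> 0" by auto
    then have "degree p' < degree p" unfolding p' by (subst degree_mult_eq) auto
    from less.hyps[OF this \<open>p' \<noteq> 0\<close>] obtain S where
      S: "S \<subseteq> {x. a < x \<and> x < b \<and> poly p' x = 0}" and
      sgn: "(\<forall>x. a < x \<and> x < b \<longrightarrow> poly p' x * (\<Prod>r\<in>S. x - r) \<ge> 0) \<or>
            (\<forall>x. a < x \<and> x < b \<longrightarrow> poly p' x * (\<Prod>r\<in>S. x - r) \<le> 0)" by blast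
    have fin: "finite S"
      by (rule finite_subset[OF _ poly_roots_finite[OF \<open>p' \<noteq> 0\<close>]]) (use S in auto)
    have px: "poly p x = (x - r) * poly p' x" for x unfolding p' by (simp add: algebra_simps)
    show ?thesis
    proof (cases "r \<in> S")
      case True
      have "poly p x * (\<Prod>r\<in>S - {r}. x - r) = poly p' x * (\<Prod>r\<in>S. x - r)" for x
        unfolding px using prod.remove[OF fin True, of "\<lambda>r. x - r"] by (simp add: mult_ac)
      with sgn have "(\<forall>x. a < x \<and> x < b \<longrightarrow> poly p x * (\<Prod>r\<in>S - {r}. x - r) \<ge> 0) \<or>
            (\<forall>x. a < x \<and> x < b \<longrightarrow> poly p x * (\<Prod>r\<in>S - {r}. x - r) \<le> 0)"
        by (simp only:)
      with S show ?thesis by (intro exI[of _ "S - {r}"]) (auto simp: px)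
    next
      case False
      have "poly p x * (\<Prod>r\<in>insert r S. x - r) = (x - r)\<^sup>2 * (poly p' x * (\<Prod>r\<in>S. x - r))" for x
        unfolding px using False fin by (simp add: power2_eq_square mult_ac)
      with sgn have "(\<forall>x. a < x \<and> x < b \<longrightarrow> poly p x * (\<Prod>r\<in>insert r S. x - r) \<ge> 0) \<or>
            (\<forall>x. a < x \<and> x < b \<longrightarrow> poly p x * (\<Prod>r\<in>insert r S. x - r) \<le> 0)"
        by (auto simp: mult_nonneg_nonpos)
      with S r show ?thesis by (intro exI[of _ "insert r S"]) (auto simp: px)
    qed
  qed
qed

lemma has_integral_Ioo_nonneg_zero_imp_zero:
  fixes f :: "real \<Rightarrow> real"
  assumes I: "(f has_integral 0) {a<..<b}" and cont: "continuous_on {a<..<b} f"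
    and nn: "\<And>x. a < x \<Longrightarrow> x < b \<Longrightarrow> 0 \<le> f x" and x: "a < x" "x < b"
  shows "f x = 0"
proof -
  obtain u v where uv: "a < u" "u < x" "x < v" "v < b"
    using x dense[of a x] dense[of x b] by auto
  have c: "continuous_on {u..v} f" by (rule continuous_on_subset[OF cont]) (use uv in auto)
  have int: "f integrable_on {u..v}" by (rule integrable_continuous_real[OF c])
  have "integral {u..v} f \<le> integral {a<..<b} f"
    using uv int I nn by (intro integral_subset_le) auto
  moreover have "integral {u..v} f \<ge> 0"
    using uv by (intro integral_nonneg int) (auto intro: nn)
  moreover have "integral {a<..<b} f = 0" using I by (rule integral_unique)
  ultimately have "(f has_integral 0) (cbox u v)"
    using int by (simp add: has_integral_iff)
  then show ?thesis
    using uv c nn by (intro has_integral_0_cbox_imp_0[of u v f]) auto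
qed

text \<open>
  If \<open>p\<close> changed sign at fewer than \<open>n\<close> points, the product of the corresponding linear factors
  would be a polynomial of degree below \<open>n\<close> whose product with \<open>p\<close> has constant sign, contradicting
  orthogonality.
\<close>

lemma card_roots_jacobi_poly:
  assumes "is_jacobi_poly \<alpha> \<beta> n p" "p \<noteq> 0"
  shows "card {x. - 1 < x \<and> x < 1 \<and> poly p x = 0} = n"
proof -
  define Z where "Z = {x. - 1 < x \<and> x < 1 \<and> poly p x = 0}"
  have deg: "degree p = n" using assms by (simp add: is_jacobi_poly_def)
  have finZ: "finite Z"
    by (rule finite_subset[OF _ poly_roots_finite[OF \<open>p \<noteq> 0\<close>]]) (auto simp: Z_def)
  have le: "card Z \<le> n"
    using card_mono[OF poly_roots_finite[OF \<open>p \<noteq> 0\<close>], of Z] card_poly_roots_bound[OF \<open>p \<noteq> 0\<close>] deg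
    by (auto simp: Z_def intro: order.trans)
  from poly_fix_sign_changes[OF \<open>p \<noteq> 0\<close>, of "-1" 1] obtain S where
    S: "S \<subseteq> Z" and
    sgn: "(\<forall>x. -1 < x \<and> x < 1 \<longrightarrow> poly p x * (\<Prod>r\<in>S. x - r) \<ge> 0) \<or>
          (\<forall>x. -1 < x \<and> x < 1 \<longrightarrow> poly p x * (\<Prod>r\<in>S. x - r) \<le> 0)"
    unfolding Z_def by blast
  have finS: "finite S" using S finZ by (rule finite_subset)
  have "\<not> card S < n"
  proof
    assume lt: "card S < n"
    define q where "q = (\<Prod>r\<in>S. [:- r, 1:])"
    have q: "poly q x = (\<Prod>r\<in>S. x - r)" for x by (simp add: q_def poly_prod)
    have "degree q = card S" unfolding q_def by (subst degree_prod_eq_sum_degree) auto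
    have "q \<noteq> 0" unfolding q_def using finS by auto
    define f where "f x = (1 - x) powr \<alpha> * (1 + x) powr \<beta> * (poly p x * poly q x)" for x
    have I: "(f has_integral 0) {-1<..<1}"
      using assms(1) lt \<open>degree q = card S\<close> unfolding is_jacobi_poly_def f_def by auto
    have cont: "continuous_on {-1<..<1} f"
      unfolding f_def by (intro continuous_intros) auto
    have f0: "f x = 0" if x: "-1 < x" "x < 1" for x
      using sgn
    proof
      assume *: "\<forall>x. -1 < x \<and> x < 1 \<longrightarrow> poly p x * (\<Prod>r\<in>S. x - r) \<ge> 0"
      show ?thesis
        by (rule has_integral_Ioo_nonneg_zero_imp_zero[OF I cont _ x]) (use * in \<open>auto simp: f_def q\<close>)
    next
      assume *: "\<forall>x. -1 < x \<and> x < 1 \<longrightarrow> poly p x * (\<Prod>r\<in>S. x - r) \<le> 0"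
      have "((\<lambda>x. - f x) has_integral 0) {-1<..<1}" using has_integral_neg[OF I] by simp
      moreover have "continuous_on {-1<..<1} (\<lambda>x. - f x)" by (intro continuous_intros cont)
      ultimately have "- f x = 0"
        by (rule has_integral_Ioo_nonneg_zero_imp_zero[OF _ _ _ x])
           (use * in \<open>auto simp: f_def q mult_nonneg_nonpos\<close>)
      then show ?thesis by simp
    qed
    have "{-1<..<1} \<subseteq> {x. poly (p * q) x = 0}"
    proof
      fix x :: real assume "x \<in> {-1<..<1}"
      then show "x \<in> {x. poly (p * q) x = 0}" using f0[of x] by (simp add: f_def)
    qed
    moreover have "infinite {-1<..<1 :: real}" by (rule infinite_Ioo) simp
    ultimately have "infinite {x. poly (p * q) x = 0}" by (rule infinite_super)
    with \<open>p \<noteq> 0\<close> \<open>q \<noteq> 0\<close> show False using poly_roots_finite[of "p * q"] by auto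
  qed
  with card_mono[OF finZ S] le show ?thesis by (simp add: Z_def)
qed

text \<open>
  A multiple of the Jacobi polynomial in the variable \<open>t = sin\<^sup>2(\<theta>/2) = (1 - x)/2\<close>, described by its
  hypergeometric equation. The scaling is left open up to a positive factor, so that the reflection
  \<open>t \<mapsto> 1 - t\<close>, up to a sign, stays within the notion and only swaps \<open>\<alpha>\<close> and \<open>\<beta>\<close>.
\<close>

definition jacobi_solution :: "real \<Rightarrow> real \<Rightarrow> nat \<Rightarrow> real poly \<Rightarrow> bool" where
  "jacobi_solution \<alpha> \<beta> n Y \<longleftrightarrow>
     (\<forall>t. t * (1 - t) * poly (pderiv (pderiv Y)) t
          + (\<alpha> + 1 - (\<alpha> + \<beta> + 2) * t) * poly (pderiv Y) t
          + n * (n + \<alpha> + \<beta> + 1) * poly Y t = 0) \<and>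
     poly Y 0 > 0 \<and> card {t. 0 < t \<and> t < 1 \<and> poly Y t = 0} = n"

text \<open>
  The coefficient formula holds for all \<open>k\<close>, since \<open>(-n)\<^sub>k = 0\<close> for \<open>k > n\<close>. This lets the differential
  equation be checked coefficientwise without treating the top coefficient separately.
\<close>

lemma jacobi_explicit_in_half_angle_variable:
  assumes "\<alpha> > -1" "\<beta> > -1"
  defines "c \<equiv> (\<lambda>n k. ((\<alpha> + real n) gchoose n) * pochhammer (- real n) k * pochhammer (n + \<alpha> + \<beta> + 1) k
                           / (fact k * pochhammer (\<alpha> + 1) k))"
  obtains Y where "\<And>x. poly (jacobi_explicit \<alpha> \<beta> n) x = poly Y ((1 - x) / 2)" "\<And>k. coeff Y k = c n k"
proof
  define Y where "Y = (\<Sum>k\<le>n. monom (c n k) k)"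
  show "poly (jacobi_explicit \<alpha> \<beta> n) x = poly Y ((1 - x) / 2)" for x
    unfolding poly_jacobi_explicit[OF assms(1,2)] Y_def poly_sum c_def by (simp add: poly_monom)
  show "coeff Y k = c n k" for k
  proof (cases "k \<le> n")
    case True
    then show ?thesis by (simp add: Y_def coeff_sum)
  next
    case False
    then have "pochhammer (- real n) k = 0" by (intro pochhammer_of_nat_eq_0_lemma) simp
    with False show ?thesis by (simp add: Y_def coeff_sum c_def)
  qed
qed

lemma jacobi_solution_exists:
  assumes "\<alpha> > -1" "\<beta> > -1"
  obtains Y where "jacobi_solution \<alpha> \<beta> n Y" "\<And>x. poly (jacobi_poly \<alpha> \<beta> n) x = poly Y ((1 - x) / 2)"
proof -
  define c where "c k = ((\<alpha> + real n) gchoose n) * pochhammer (- real n) k * pochhammer (n + \<alpha> + \<beta> + 1) k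
                           / (fact k * pochhammer (\<alpha> + 1) k)" for k
  obtain Y where Y: "\<And>x. poly (jacobi_explicit \<alpha> \<beta> n) x = poly Y ((1 - x) / 2)" and c: "\<And>k. coeff Y k = c k"
    using jacobi_explicit_in_half_angle_variable[OF assms] unfolding c_def by metis
  have pY: "poly (jacobi_poly \<alpha> \<beta> n) x = poly Y ((1 - x) / 2)" for x
    using Y by (simp add: jacobi_poly_eq_explicit[OF assms])
  have rec: "(real k + 1) * (\<alpha> + 1 + real k) * c (Suc k) = (real k - real n) * (real n + \<alpha> + \<beta> + 1 + real k) * c k" for k
  proof -
    have "pochhammer (\<alpha> + 1) k > 0" using assms by (intro pochhammer_pos) auto
    moreover have "\<alpha> + 1 + k > 0" using assms by simp
    ultimately show ?thesis
      unfolding c_def pochhammer_Suc fact_Suc by (simp add: divide_simps)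
  qed
  define E where "E = [:0, 1, -1:] * pderiv (pderiv Y) + [:\<alpha> + 1, - (\<alpha> + \<beta> + 2):] * pderiv Y
                      + [:n * (n + \<alpha> + \<beta> + 1):] * Y"
  have "coeff E k = 0" for k
  proof -
    have c1: "coeff (pderiv Y) j = (real j + 1) * c (Suc j)" for j by (simp add: coeff_pderiv c)
    have c2: "coeff (pderiv (pderiv Y)) j = (real j + 1) * ((real j + 2) * c (Suc (Suc j)))" for j
      by (simp add: coeff_pderiv c algebra_simps)
    have "coeff E k = (real k + 1) * (\<alpha> + 1 + real k) * c (Suc k) - (real k - real n) * (real n + \<alpha> + \<beta> + 1 + real k) * c k"
    proof (cases k)
      case 0
      then show ?thesis by (simp add: E_def c c1 c2 coeff_pCons algebra_simps)
    next
      case (Suc j)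
      show ?thesis
        by (cases j) (simp_all add: E_def c c1 c2 coeff_pCons Suc algebra_simps)
    qed
    then show ?thesis by (simp only: rec diff_self)
  qed
  then have "E = 0" by (simp add: poly_eq_iff)
  then have ode: "poly E t = 0" for t by simp
  have "poly (jacobi_poly \<alpha> \<beta> n) 1 > 0"
    using is_jacobi_poly_jacobi_poly[OF assms, of n] add_gchoose_pos[OF assms(1)]
    by (simp add: is_jacobi_poly_def)
  then have pos: "poly Y 0 > 0" using pY[of 1] by simp
  then have "jacobi_poly \<alpha> \<beta> n \<noteq> 0" using pY[of 1] by auto
  then have "n = card {x. - 1 < x \<and> x < 1 \<and> poly (jacobi_poly \<alpha> \<beta> n) x = 0}"
    using card_roots_jacobi_poly[OF is_jacobi_poly_jacobi_poly[OF assms]] by simp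
  also have "\<dots> = card {t. 0 < t \<and> t < 1 \<and> poly Y t = 0}"
    by (rule bij_betw_same_card[of "\<lambda>x. (1 - x) / 2"], rule bij_betw_byWitness[of _ "\<lambda>t. 1 - 2 * t"])
       (auto simp: pY diff_divide_distrib)
  finally have card: "card {t. 0 < t \<and> t < 1 \<and> poly Y t = 0} = n" by simp
  show ?thesis
  proof (rule that[OF _ pY])
    show "jacobi_solution \<alpha> \<beta> n Y"
      unfolding jacobi_solution_def using ode pos card by (auto simp: E_def algebra_simps)
  qed
qed

text \<open>
  The \<open>n\<close> roots in the open interval already exhaust the degree.
\<close>

lemma jacobi_poly_minus_one_nonzero:
  assumes "\<alpha> > -1" "\<beta> > -1"
  shows "poly (jacobi_poly \<alpha> \<beta> n) (-1) \<noteq> 0"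
proof
  assume z: "poly (jacobi_poly \<alpha> \<beta> n) (-1) = 0"
  let ?p = "jacobi_poly \<alpha> \<beta> n"
  note jp = is_jacobi_poly_jacobi_poly[OF assms, of n]
  have "?p \<noteq> 0"
    using jp add_gchoose_pos[OF assms(1), of n] by (auto simp: is_jacobi_poly_def)
  let ?Z = "{x. - 1 < x \<and> x < 1 \<and> poly ?p x = 0}"
  have "finite ?Z" by (rule finite_subset[OF _ poly_roots_finite[OF \<open>?p \<noteq> 0\<close>]]) auto
  then have "Suc n = card (insert (-1) ?Z)"
    using card_roots_jacobi_poly[OF jp \<open>?p \<noteq> 0\<close>] by (subst card_insert_disjoint) auto
  also have "\<dots> \<le> card {x. poly ?p x = 0}"
    using z by (intro card_mono poly_roots_finite[OF \<open>?p \<noteq> 0\<close>]) auto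
  also have "\<dots> \<le> n"
    using card_poly_roots_bound[OF \<open>?p \<noteq> 0\<close>] jp by (simp add: is_jacobi_poly_def)
  finally show False by simp
qed

lemma jacobi_solution_reflect:
  assumes "jacobi_solution \<alpha> \<beta> n Y" "poly Y 1 \<noteq> 0" 
  shows "jacobi_solution \<beta> \<alpha> n (smult (sgn (poly Y 1)) (pcompose Y [:1, -1:]))"
proof -
  define R where "R = pcompose Y [:1, -1:]"
  have R0: "poly R t = poly Y (1 - t)" for t by (simp add: R_def poly_pcompose)
  have R1: "poly (pderiv R) t = - poly (pderiv Y) (1 - t)" for t
    by (simp add: R_def pderiv_pcompose poly_pcompose pderiv_pCons)
  have R2: "poly (pderiv (pderiv R)) t = poly (pderiv (pderiv Y)) (1 - t)" for t
    by (simp add: R_def pderiv_pcompose poly_pcompose pderiv_pCons pderiv_minus pderiv_mult)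
  define s where "s = sgn (poly Y 1)"
  have s: "s \<noteq> 0" "s * poly Y 1 > 0" using assms(2) by (auto simp: s_def sgn_if)
  have "t * (1 - t) * poly (pderiv (pderiv R)) t + (\<beta> + 1 - (\<beta> + \<alpha> + 2) * t) * poly (pderiv R) t
          + n * (n + \<beta> + \<alpha> + 1) * poly R t = 0" for t
  proof -
    have "(1 - t) * (1 - (1 - t)) * poly (pderiv (pderiv Y)) (1 - t)
          + (\<alpha> + 1 - (\<alpha> + \<beta> + 2) * (1 - t)) * poly (pderiv Y) (1 - t)
          + n * (n + \<alpha> + \<beta> + 1) * poly Y (1 - t) = 0"
      using assms(1) unfolding jacobi_solution_def by blast
    then show ?thesis by (simp add: R0 R1 R2 algebra_simps)
  qed
  from this have "s * (t * (1 - t) * poly (pderiv (pderiv R)) t + (\<beta> + 1 - (\<beta> + \<alpha> + 2) * t) * poly (pderiv R) t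
          + n * (n + \<beta> + \<alpha> + 1) * poly R t) = 0" for t by simp
  moreover have "card {t. 0 < t \<and> t < 1 \<and> poly (smult s R) t = 0} = card {t. 0 < t \<and> t < 1 \<and> poly Y t = 0}"
    by (rule bij_betw_same_card[of "\<lambda>x. 1 - x"], rule bij_betw_byWitness[of _ "\<lambda>t. 1 - t"])
       (use s in \<open>auto simp: R0\<close>)
  ultimately show ?thesis
    using assms(1) s unfolding jacobi_solution_def s_def[symmetric] R_def[symmetric]
    by (auto simp: R0 pderiv_smult algebra_simps)
qed

section \<open>Angles of the zeros\<close>

definition zero_angles :: "real poly \<Rightarrow> real set" where
  "zero_angles Y = {\<theta>. 0 < \<theta> \<and> \<theta> < pi \<and> poly Y ((sin (\<theta> / 2))\<^sup>2) = 0}"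

definition zero_angle :: "real poly \<Rightarrow> nat \<Rightarrow> real" where
  "zero_angle Y k = sorted_list_of_set (zero_angles Y) ! (k - 1)"

lemma sin_half_squared: "(sin (\<theta> / 2))\<^sup>2 = (1 - cos \<theta>) / 2" for \<theta> :: real
  using cos_double_sin[of "\<theta> / 2"] by simp

lemma card_zero_angles: "card (zero_angles Y) = card {t. 0 < t \<and> t < 1 \<and> poly Y t = 0}"
proof (rule bij_betw_same_card[of "\<lambda>\<theta>. (1 - cos \<theta>) / 2"], rule bij_betw_byWitness[of _ "\<lambda>t. arccos (1 - 2 * t)"])
  have cos_bounds: "- 1 < cos \<theta>" "cos \<theta> < 1" if "0 < \<theta>" "\<theta> < pi" for \<theta>
    using that cos_monotone_0_pi[of 0 \<theta>] cos_monotone_0_pi[of \<theta> pi] by auto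
  show "\<forall>\<theta>\<in>zero_angles Y. arccos (1 - 2 * ((1 - cos \<theta>) / 2)) = \<theta>"
    by (auto simp: zero_angles_def arccos_cos diff_divide_distrib)
  show "\<forall>t\<in>{t. 0 < t \<and> t < 1 \<and> poly Y t = 0}. (1 - cos (arccos (1 - 2 * t))) / 2 = t"
    by auto
  show "(\<lambda>\<theta>. (1 - cos \<theta>) / 2) ` zero_angles Y \<subseteq> {t. 0 < t \<and> t < 1 \<and> poly Y t = 0}"
    using cos_bounds by (auto simp: zero_angles_def sin_half_squared)
  show "(\<lambda>t. arccos (1 - 2 * t)) ` {t. 0 < t \<and> t < 1 \<and> poly Y t = 0} \<subseteq> zero_angles Y"
    using arccos_lt_bounded by (auto simp: zero_angles_def sin_half_squared)
qed

lemma finite_zero_angles: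
  assumes "jacobi_solution \<alpha> \<beta> n Y"
  shows "finite (zero_angles Y)" "card (zero_angles Y) = n"
proof -
  show c: "card (zero_angles Y) = n"
    using assms by (simp add: card_zero_angles jacobi_solution_def)
  have "Y \<noteq> 0" using assms by (auto simp: jacobi_solution_def)
  have "inj_on (\<lambda>\<theta>. (sin (\<theta> / 2))\<^sup>2) (zero_angles Y)"
    by (auto simp: inj_on_def zero_angles_def sin_half_squared intro: cos_inj_pi)
  moreover have "(\<lambda>\<theta>. (sin (\<theta> / 2))\<^sup>2) ` zero_angles Y \<subseteq> {t. poly Y t = 0}"
    by (auto simp: zero_angles_def)
  ultimately show "finite (zero_angles Y)"
    using poly_roots_finite[OF \<open>Y \<noteq> 0\<close>] finite_subset finite_imageD by metis
qed

lemma zero_angle_first: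
  assumes "jacobi_solution \<alpha> \<beta> n Y" "n \<ge> 1"
  shows "0 < zero_angle Y 1" "zero_angle Y 1 < pi" "zero_angle Y 1 \<in> zero_angles Y"
    "\<And>\<theta>. \<theta> \<in> zero_angles Y \<Longrightarrow> zero_angle Y 1 \<le> \<theta>"
proof -
  let ?l = "sorted_list_of_set (zero_angles Y)"
  note f = finite_zero_angles[OF assms(1)]
  have len: "length ?l = n" "set ?l = zero_angles Y" using f by auto
  have "?l ! (1 - 1) \<in> set ?l"
    using len(1) assms(2) by (intro nth_mem) auto
  then show "zero_angle Y 1 \<in> zero_angles Y"
    by (simp only: zero_angle_def len(2))
  then show "0 < zero_angle Y 1" "zero_angle Y 1 < pi" by (auto simp: zero_angles_def)
  fix \<theta> assume "\<theta> \<in> zero_angles Y"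
  then obtain i where "i < n" "\<theta> = ?l ! i" using len by (metis in_set_conv_nth)
  then show "zero_angle Y 1 \<le> \<theta>"
    using len(1) by (auto simp: zero_angle_def intro!: sorted_nth_mono)
qed

lemma zero_angle_second:
  assumes "jacobi_solution \<alpha> \<beta> n Y" "n \<ge> 2"
  shows "zero_angle Y 1 < zero_angle Y 2" "zero_angle Y 2 < pi" "zero_angle Y 2 \<in> zero_angles Y"
    "\<And>\<theta>. \<theta> \<in> zero_angles Y \<Longrightarrow> zero_angle Y 1 < \<theta> \<Longrightarrow> zero_angle Y 2 \<le> \<theta>"
proof -
  let ?l = "sorted_list_of_set (zero_angles Y)"
  note f = finite_zero_angles[OF assms(1)]
  have len: "length ?l = n" "set ?l = zero_angles Y" using f by auto
  have "?l ! (2 - 1) \<in> set ?l"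
    using len(1) assms(2) by (intro nth_mem) auto
  then show "zero_angle Y 2 \<in> zero_angles Y"
    by (simp only: zero_angle_def len(2))
  then show "zero_angle Y 2 < pi" by (auto simp: zero_angles_def)
  show "zero_angle Y 1 < zero_angle Y 2"
    using strict_sorted_list_of_set[of "zero_angles Y"] len(1) assms(2)
    unfolding sorted_wrt_iff_nth_less by (auto simp: zero_angle_def)
  fix \<theta> assume "\<theta> \<in> zero_angles Y" "zero_angle Y 1 < \<theta>"
  moreover from this obtain i where "i < n" "\<theta> = ?l ! i" using len by (metis in_set_conv_nth)
  ultimately show "zero_angle Y 2 \<le> \<theta>"
    using len(1) by (cases i) (auto simp: zero_angle_def intro!: sorted_nth_mono)
qed

lemma sorted_list_of_set_reflect:
  fixes S :: "real set"
  assumes "finite S"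
  shows "sorted_list_of_set ((\<lambda>x. c - x) ` S) = rev (map (\<lambda>x. c - x) (sorted_list_of_set S))"
proof (rule sorted_distinct_set_unique)
  show "sorted (rev (map (\<lambda>x. c - x) (sorted_list_of_set S)))"
    using sorted_sorted_list_of_set[of S]
    by (simp add: sorted_wrt_rev sorted_wrt_map)
  show "distinct (rev (map (\<lambda>x. c - x) (sorted_list_of_set S)))"
    by (simp add: distinct_map inj_on_def)
qed (use assms in auto)

text \<open>
  The factor \<open>c\<close> leaves room for the sign that makes the reflected polynomial positive at \<open>0\<close>.
\<close>

lemma zero_angle_reflect:
  assumes "jacobi_solution \<alpha> \<beta> n Y" "c \<noteq> 0" "1 \<le> k" "k \<le> n"
  shows "zero_angle (smult c (pcompose Y [:1, -1:])) k = pi - zero_angle Y (n + 1 - k)"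
proof -
  note f = finite_zero_angles[OF assms(1)]
  have s: "(sin ((pi - \<theta>) / 2))\<^sup>2 = 1 - (sin (\<theta> / 2))\<^sup>2" for \<theta>
    by (simp add: sin_half_squared field_simps)
  have p: "poly (smult c (pcompose Y [:1, -1:])) t = c * poly Y (1 - t)" for t
    by (simp add: poly_pcompose)
  have "zero_angles (smult c (pcompose Y [:1, -1:])) = (\<lambda>x. pi - x) ` zero_angles Y"
  proof (intro equalityI subsetI)
    fix \<theta> assume "\<theta> \<in> zero_angles (smult c (pcompose Y [:1, -1:]))"
    then have "pi - \<theta> \<in> zero_angles Y" using assms(2) unfolding zero_angles_def p by (auto simp: s)
    then show "\<theta> \<in> (\<lambda>x. pi - x) ` zero_angles Y" by (intro image_eqI[of _ _ "pi - \<theta>"]) auto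
  next
    fix \<theta> assume "\<theta> \<in> (\<lambda>x. pi - x) ` zero_angles Y"
    then show "\<theta> \<in> zero_angles (smult c (pcompose Y [:1, -1:]))" 
      unfolding zero_angles_def p by (auto simp: s)
  qed
  then have "zero_angle (smult c (pcompose Y [:1, -1:])) k =
      rev (map (\<lambda>x. pi - x) (sorted_list_of_set (zero_angles Y))) ! (k - 1)"
    unfolding zero_angle_def by (simp only: sorted_list_of_set_reflect[OF f(1)])
  also have "\<dots> = pi - sorted_list_of_set (zero_angles Y) ! (n - k)"
    using assms f by (subst rev_nth) auto
  finally show ?thesis by (simp add: zero_angle_def)
qed

lemma jacobi_theta_eq_zero_angle:
  assumes "\<And>x. poly (jacobi_poly \<alpha> \<beta> n) x = poly Y ((1 - x) / 2)"
  shows "jacobi_theta \<alpha> \<beta> n k = zero_angle Y k"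
  by (simp add: jacobi_theta_def zero_angle_def zero_angles_def assms sin_half_squared)

section \<open>Liouville normal form\<close>

text \<open>
  The factor that turns the Jacobi equation into one without first-order term; its square is the
  orthogonality weight transported to the angle \<open>\<theta>\<close>, up to a constant.
\<close>

definition liouville_weight :: "real \<Rightarrow> real \<Rightarrow> real \<Rightarrow> real" where
  "liouville_weight \<alpha> \<beta> \<theta> = sin (\<theta> / 2) powr (\<alpha> + 1 / 2) * cos (\<theta> / 2) powr (\<beta> + 1 / 2)"

definition liouville_logderiv :: "real \<Rightarrow> real \<Rightarrow> real \<Rightarrow> real" where
  "liouville_logderiv \<alpha> \<beta> \<theta> =
     (\<alpha> + 1 / 2) / 2 * (cos (\<theta> / 2) / sin (\<theta> / 2)) - (\<beta> + 1 / 2) / 2 * (sin (\<theta> / 2) / cos (\<theta> / 2))"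

definition liouville :: "real \<Rightarrow> real \<Rightarrow> real poly \<Rightarrow> real \<Rightarrow> real" where
  "liouville \<alpha> \<beta> Y \<theta> = liouville_weight \<alpha> \<beta> \<theta> * poly Y ((sin (\<theta> / 2))\<^sup>2)"

definition liouville' :: "real \<Rightarrow> real \<Rightarrow> real poly \<Rightarrow> real \<Rightarrow> real" where
  "liouville' \<alpha> \<beta> Y \<theta> = liouville_weight \<alpha> \<beta> \<theta> *
     (poly (pderiv Y) ((sin (\<theta> / 2))\<^sup>2) * (sin (\<theta> / 2) * cos (\<theta> / 2))
      + liouville_logderiv \<alpha> \<beta> \<theta> * poly Y ((sin (\<theta> / 2))\<^sup>2))"

text \<open>
  The potential of the normal form is \<open>\<gamma>\<^sup>2 + A / sin\<^sup>2(\<theta>/2) + B / cos\<^sup>2(\<theta>/2)\<close>. This function is what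
  remains after splitting off \<open>\<gamma>\<^sup>2\<close> and the singular part \<open>4A / \<theta>\<^sup>2\<close>, multiplied by \<open>\<theta>\<^sup>2\<close>. The
  factor makes its value at \<open>\<theta> = x / \<gamma>\<close>, divided by \<open>x\<^sup>2\<close>, the whole dependence on the degree after
  rescaling.
\<close>

definition potential_excess :: "real \<Rightarrow> real \<Rightarrow> real \<Rightarrow> real" where
  "potential_excess \<alpha> \<beta> \<theta> =
     jacobi_A \<alpha> * (\<theta>\<^sup>2 / (sin (\<theta> / 2))\<^sup>2 - 4) + jacobi_B \<beta> * (\<theta>\<^sup>2 / (cos (\<theta> / 2))\<^sup>2)"

lemma DERIV_sin_half: "((\<lambda>x. sin (x / 2)) has_real_derivative cos (\<theta> / 2) / 2) (at \<theta>)"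
  by (auto intro!: derivative_eq_intros)

lemma DERIV_cos_half: "((\<lambda>x. cos (x / 2)) has_real_derivative - sin (\<theta> / 2) / 2) (at \<theta>)"
  by (auto intro!: derivative_eq_intros)

lemma DERIV_liouville_weight:
  assumes "0 < \<theta>" "\<theta> < pi"
  shows "(liouville_weight \<alpha> \<beta> has_real_derivative
            liouville_weight \<alpha> \<beta> \<theta> * liouville_logderiv \<alpha> \<beta> \<theta>) (at \<theta>)"
proof -
  have s: "sin (\<theta> / 2) > 0" "cos (\<theta> / 2) > 0"
    using assms by (auto intro!: sin_gt_zero cos_gt_zero)
  have 1: "((\<lambda>x. sin (x / 2) powr a) has_real_derivative
              sin (\<theta> / 2) powr a * (a / 2 * (cos (\<theta> / 2) / sin (\<theta> / 2)))) (at \<theta>)" for a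
    using DERIV_fun_powr[OF DERIV_sin_half, of \<theta> a] s by (simp add: powr_diff mult_ac)
  have 2: "((\<lambda>x. cos (x / 2) powr b) has_real_derivative
              cos (\<theta> / 2) powr b * (- b / 2 * (sin (\<theta> / 2) / cos (\<theta> / 2)))) (at \<theta>)" for b
    using DERIV_fun_powr[OF DERIV_cos_half, of \<theta> b] s by (simp add: powr_diff mult_ac)
  show ?thesis
    unfolding liouville_weight_def liouville_logderiv_def
    by (rule DERIV_cong[OF DERIV_mult[OF 1 2]]) (use s in \<open>simp add: field_simps\<close>)
qed

lemma DERIV_liouville:
  assumes "0 < \<theta>" "\<theta> < pi"
  shows "(liouville \<alpha> \<beta> Y has_real_derivative liouville' \<alpha> \<beta> Y \<theta>) (at \<theta>)"
  unfolding liouville_def liouville'_def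
  apply (rule derivative_eq_intros refl DERIV_liouville_weight assms | simp)+
  by (simp add: algebra_simps)

text \<open>
  Writing \<open>u = \<omega> z\<close> with \<open>\<omega>' = m \<omega>\<close> gives \<open>u'' = \<omega> (z'' + 2 m z' + (m' + m\<^sup>2) z)\<close>. The hypergeometric
  equation evaluates \<open>z'' + 2 m z'\<close> as \<open>-n (n + 2\<rho>) z\<close>, and \<open>m' + m\<^sup>2\<close> contributes the two poles and
  the \<open>-\<rho>\<^sup>2\<close> that completes \<open>n (n + 2\<rho>)\<close> to \<open>\<gamma>\<^sup>2\<close>.
\<close>

lemma DERIV_liouville':
  assumes "0 < \<theta>" "\<theta> < pi" "jacobi_solution \<alpha> \<beta> n Y"
  shows "(liouville' \<alpha> \<beta> Y has_real_derivative
            - ((jacobi_gamma \<alpha> \<beta> n)\<^sup>2 + (4 * jacobi_A \<alpha> + potential_excess \<alpha> \<beta> \<theta>) / \<theta>\<^sup>2)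
            * liouville \<alpha> \<beta> Y \<theta>) (at \<theta>)"
proof -
  define s c where "s = sin (\<theta> / 2)" and "c = cos (\<theta> / 2)"
  have p: "s > 0" "c > 0"
    using assms by (auto intro!: sin_gt_zero cos_gt_zero simp: s_def c_def)
  have sc: "c\<^sup>2 = 1 - s\<^sup>2" unfolding s_def c_def by (simp add: cos_squared_eq)
  define y0 y1 y2 where "y0 = poly Y (s\<^sup>2)" and "y1 = poly (pderiv Y) (s\<^sup>2)" and "y2 = poly (pderiv (pderiv Y)) (s\<^sup>2)"
  define m where "m = liouville_logderiv \<alpha> \<beta> \<theta>"
  define m' where "m' = - (\<alpha> + 1 / 2) / (4 * s\<^sup>2) - (\<beta> + 1 / 2) / (4 * c\<^sup>2)"
  have dm: "(liouville_logderiv \<alpha> \<beta> has_real_derivative m') (at \<theta>)"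
  proof -
    have e: "m' = (\<alpha> + 1 / 2) / 2 * ((- s / 2 * s - c * (c / 2)) / (s * s)) - (\<beta> + 1 / 2) / 2 * ((c / 2 * c - s * (- s / 2)) / (c * c))"
    proof -
      have "- s / 2 * s - c * (c / 2) = - 1 / 2" "c / 2 * c - s * (- s / 2) = 1/2"
        using sc by (auto simp: power2_eq_square algebra_simps)
      then have "?thesis \<longleftrightarrow> m' = (\<alpha> + 1 / 2) / 2 * ((- 1 / 2) / (s * s)) - (\<beta> + 1 / 2) / 2 * ((1 / 2) / (c * c))"
        by (simp only:)
      then show ?thesis using p by (simp add: m'_def power2_eq_square field_simps)
    qed
    show ?thesis
      unfolding liouville_logderiv_def e s_def c_def
      by (intro DERIV_diff DERIV_cmult DERIV_divide DERIV_sin_half DERIV_cos_half)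
         (use p in \<open>simp_all add: s_def c_def\<close>)
  qed
  have m2: "m' + m\<^sup>2 = - (jacobi_A \<alpha> / s\<^sup>2 + jacobi_B \<beta> / c\<^sup>2) - (jacobi_rho \<alpha> \<beta>)\<^sup>2"
  proof -
    have "(P / 2 * (c / s) - Q / 2 * (s / c))\<^sup>2 = P\<^sup>2 / 4 * (c\<^sup>2 / s\<^sup>2) + Q\<^sup>2 / 4 * (s\<^sup>2 / c\<^sup>2) - P * Q / 2" for P Q
      using p by (simp add: field_simps power2_eq_square)
    moreover have "m = (\<alpha> + 1 / 2) / 2 * (c / s) - (\<beta> + 1 / 2) / 2 * (s / c)"
      by (simp add: m_def liouville_logderiv_def s_def c_def)
    ultimately have "m\<^sup>2 = (\<alpha> + 1 / 2)\<^sup>2 / 4 * (c\<^sup>2 / s\<^sup>2) + (\<beta> + 1 / 2)\<^sup>2 / 4 * (s\<^sup>2 / c\<^sup>2) - (\<alpha> + 1 / 2) * (\<beta> + 1 / 2) / 2"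
      by (simp only:)
    moreover have "c\<^sup>2 / s\<^sup>2 = 1 / s\<^sup>2 - 1" "s\<^sup>2 / c\<^sup>2 = 1 / c\<^sup>2 - 1"
      using p sc by (auto simp: field_simps)
    moreover define S T where "S = 1 / s\<^sup>2" and "T = 1 / c\<^sup>2"
    ultimately have "m\<^sup>2 = (\<alpha> + 1 / 2)\<^sup>2 / 4 * (S - 1) + (\<beta> + 1 / 2)\<^sup>2 / 4 * (T - 1) - (\<alpha> + 1 / 2) * (\<beta> + 1 / 2) / 2"
      by (simp only:)
    moreover have "m' = - (\<alpha> + 1 / 2) / 4 * S - (\<beta> + 1 / 2) / 4 * T"
      by (simp add: m'_def S_def T_def)
    ultimately have "m' + m\<^sup>2 = - (jacobi_A \<alpha> * S + jacobi_B \<beta> * T) - (jacobi_rho \<alpha> \<beta>)\<^sup>2"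
      by (simp add: jacobi_A_def jacobi_B_def jacobi_rho_def field_simps power2_eq_square)
    then show ?thesis by (simp add: S_def T_def)
  qed
  have 1: "(liouville' \<alpha> \<beta> Y has_real_derivative liouville_weight \<alpha> \<beta> \<theta> *
     (y2 * (s * c)\<^sup>2 + y1 * (c\<^sup>2 - s\<^sup>2) / 2 + 2 * m * (y1 * (s * c)) + (m' + m\<^sup>2) * y0)) (at \<theta>)"
    unfolding liouville'_def
    apply (rule derivative_eq_intros refl DERIV_liouville_weight dm assms | simp)+
    by (simp add: s_def[symmetric] c_def[symmetric] y0_def[symmetric] y1_def[symmetric] y2_def[symmetric] m_def[symmetric])
       (simp add: field_simps power2_eq_square)
  have msc: "m * (s * c) = (\<alpha> + 1 / 2) / 2 * c\<^sup>2 - (\<beta> + 1 / 2) / 2 * s\<^sup>2"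
    using p unfolding m_def liouville_logderiv_def s_def[symmetric] c_def[symmetric]
    by (simp add: field_simps power2_eq_square)
  have "s\<^sup>2 * (1 - s\<^sup>2) * y2 + (\<alpha> + 1 - (\<alpha> + \<beta> + 2) * s\<^sup>2) * y1 + n * (n + \<alpha> + \<beta> + 1) * y0 = 0"
    using assms(3) unfolding jacobi_solution_def y0_def y1_def y2_def by blast
  moreover have "y2 * (s * c)\<^sup>2 + y1 * (c\<^sup>2 - s\<^sup>2) / 2 + 2 * m * (y1 * (s * c))
     = s\<^sup>2 * (1 - s\<^sup>2) * y2 + (\<alpha> + 1 - (\<alpha> + \<beta> + 2) * s\<^sup>2) * y1"
  proof -
    have "2 * m * (y1 * (s * c)) = 2 * y1 * (m * (s * c))" by simp
    then show ?thesis unfolding msc power_mult_distrib sc by (simp add: field_simps)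
  qed
  \<comment> \<open>The coefficient of the first derivative is the one in the hypergeometric equation at \<open>t = s\<^sup>2\<close>.\<close>
  ultimately have 2: "y2 * (s * c)\<^sup>2 + y1 * (c\<^sup>2 - s\<^sup>2) / 2 + 2 * m * (y1 * (s * c)) = - (n * (n + \<alpha> + \<beta> + 1)) * y0"
    by simp
  have 3: "(jacobi_gamma \<alpha> \<beta> n)\<^sup>2 = n * (n + \<alpha> + \<beta> + 1) + (jacobi_rho \<alpha> \<beta>)\<^sup>2"
    by (simp add: jacobi_gamma_def jacobi_rho_def field_simps power2_eq_square)
  have 4: "(4 * jacobi_A \<alpha> + potential_excess \<alpha> \<beta> \<theta>) / \<theta>\<^sup>2 = jacobi_A \<alpha> / s\<^sup>2 + jacobi_B \<beta> / c\<^sup>2"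
    using assms(1) p by (simp add: potential_excess_def s_def[symmetric] c_def[symmetric] field_simps)
  show ?thesis
    using 1 unfolding 2 m2 4 3
    by (simp add: liouville_def s_def[symmetric] y0_def[symmetric] algebra_simps)
qed

section \<open>The part of the potential that is regular at the endpoint\<close>

lemma potential_excess_tendsto_0: "(potential_excess \<alpha> \<beta> \<longlongrightarrow> 0) (at_right 0)"
proof -
  have "((\<lambda>\<theta>. jacobi_A \<alpha> * (\<theta>\<^sup>2 / (sin (\<theta> / 2))\<^sup>2 - 4) + jacobi_B \<beta> * (\<theta>\<^sup>2 / (cos (\<theta> / 2))\<^sup>2))
          \<longlongrightarrow> jacobi_A \<alpha> * 0 + jacobi_B \<beta> * 0) (at_right 0)"
  proof (intro tendsto_add tendsto_mult tendsto_const)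
    show "((\<lambda>x::real. x\<^sup>2 / (sin (x / 2))\<^sup>2 - 4) \<longlongrightarrow> 0) (at_right 0)"
      by (real_asymp simp: power2_eq_square)
    show "((\<lambda>x::real. x\<^sup>2 / (cos (x / 2))\<^sup>2) \<longlongrightarrow> 0) (at_right 0)" by real_asymp
  qed
  then show ?thesis by (simp add: potential_excess_def[abs_def])
qed

text \<open>
  The derivative at \<open>\<theta>\<close> is \<open>\<theta> K(\<theta>)\<close>, where \<open>K(\<theta>)\<close> tends to \<open>2A/3 + 2B = 2C/3\<close> at \<open>0\<close>.
\<close>

lemma potential_excess_strict_mono:
  assumes "jacobi_C \<alpha> \<beta> \<noteq> 0"
  obtains \<delta> where "\<delta> > 0"
    "\<And>x y. 0 < x \<Longrightarrow> x < y \<Longrightarrow> y < \<delta> \<Longrightarrow>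
       sgn (jacobi_C \<alpha> \<beta>) * potential_excess \<alpha> \<beta> x < sgn (jacobi_C \<alpha> \<beta>) * potential_excess \<alpha> \<beta> y"
proof -
  define K :: "real \<Rightarrow> real" where "K = (\<lambda>\<theta>. jacobi_A \<alpha> * ((2 * sin (\<theta> / 2) - \<theta> * cos (\<theta> / 2)) / sin (\<theta> / 2) ^ 3)
     + jacobi_B \<beta> * (2 / cos (\<theta> / 2) ^ 2 + \<theta> * sin (\<theta> / 2) / cos (\<theta> / 2) ^ 3))"
  define c where "c = sgn (jacobi_C \<alpha> \<beta>)"
  have "(K \<longlongrightarrow> jacobi_A \<alpha> * (2 / 3) + jacobi_B \<beta> * 2) (at_right 0)"
    unfolding K_def
  proof (intro tendsto_add tendsto_mult tendsto_const)
    show "((\<lambda>x::real. (2 * sin (x / 2) - x * cos (x / 2)) / sin (x / 2) ^ 3) \<longlongrightarrow> 2 / 3) (at_right 0)"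
      by (real_asymp simp: power3_eq_cube)
    show "((\<lambda>x::real. 2 / cos (x / 2) ^ 2 + x * sin (x / 2) / cos (x / 2) ^ 3) \<longlongrightarrow> 2) (at_right 0)"
      by real_asymp
  qed
  then have "((\<lambda>x. c * K x) \<longlongrightarrow> c * (jacobi_A \<alpha> * (2 / 3) + jacobi_B \<beta> * 2)) (at_right 0)"
    by (intro tendsto_intros)
  moreover have "c * (jacobi_A \<alpha> * (2 / 3) + jacobi_B \<beta> * 2) = 2 / 3 * \<bar>jacobi_C \<alpha> \<beta>\<bar>"
    unfolding c_def by (simp add: jacobi_C_def sgn_if abs_if)
  ultimately have "\<forall>\<^sub>F x in at_right 0. c * K x > 0"
    using assms by (auto intro: order_tendstoD)
  then obtain d where d: "d > 0" "\<And>x. 0 < x \<Longrightarrow> x < d \<Longrightarrow> c * K x > 0"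
    unfolding eventually_at_right_field by auto
  have deriv: "(potential_excess \<alpha> \<beta> has_real_derivative x * K x) (at x)" if x: "0 < x" "x < pi" for x
  proof -
    have p: "sin (x / 2) > 0" "cos (x / 2) > 0"
      using x by (auto intro!: sin_gt_zero cos_gt_zero)
    have 1: "((\<lambda>x. x\<^sup>2 / (sin (x / 2))\<^sup>2 - 4) has_real_derivative x * ((2 * sin (x / 2) - x * cos (x / 2)) / sin (x / 2) ^ 3)) (at x)"
      by (rule DERIV_cong[OF DERIV_diff[OF DERIV_divide[OF DERIV_power[OF DERIV_ident] DERIV_power[OF DERIV_sin_half]] DERIV_const]])
         (use p in \<open>simp_all add: field_simps power2_eq_square power3_eq_cube\<close>)
    have 2: "((\<lambda>x. x\<^sup>2 / (cos (x / 2))\<^sup>2) has_real_derivative x * (2 / cos (x / 2) ^ 2 + x * sin (x / 2) / cos (x / 2) ^ 3)) (at x)"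
      by (rule DERIV_cong[OF DERIV_divide[OF DERIV_power[OF DERIV_ident] DERIV_power[OF DERIV_cos_half]]])
         (use p in \<open>simp_all add: field_simps power2_eq_square power3_eq_cube\<close>)
    show ?thesis
      unfolding potential_excess_def[abs_def] K_def
      by (rule DERIV_cong[OF DERIV_add[OF DERIV_cmult[OF 1] DERIV_cmult[OF 2]]]) (simp add: algebra_simps)
  qed
  show ?thesis
  proof (rule that[of "min d pi"])
    fix x y :: real assume xy: "0 < x" "x < y" "y < min d pi"
    have "c * potential_excess \<alpha> \<beta> x < c * potential_excess \<alpha> \<beta> y"
    proof (rule DERIV_pos_imp_increasing[OF \<open>x < y\<close>])
      fix t assume t: "x \<le> t" "t \<le> y"
      then have "((\<lambda>x. c * potential_excess \<alpha> \<beta> x) has_real_derivative c * (t * K t)) (at t)"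
        using xy by (intro DERIV_cmult deriv) auto
      moreover have "t * (c * K t) > 0" using d(2)[of t] t xy by (intro mult_pos_pos[of t]) auto
      ultimately show "\<exists>y. ((\<lambda>x. c * potential_excess \<alpha> \<beta> x) has_real_derivative y) (at t) \<and> 0 < y"
        by (intro exI[of _ "c * (t * K t)"]) (auto simp: mult_ac)
    qed
    then show "sgn (jacobi_C \<alpha> \<beta>) * potential_excess \<alpha> \<beta> x < sgn (jacobi_C \<alpha> \<beta>) * potential_excess \<alpha> \<beta> y"
      by (simp add: c_def)
  qed (use d in auto)
qed

section \<open>Behaviour of the normal form at the endpoint\<close>

text \<open>
  Both functions behave like \<open>x\<^sup>a\<close> times a function with a finite slope at \<open>0\<close>. Replacing each
  derivative \<open>g\<close> by \<open>g - (a/x) f\<close> does not change the Wronskian and cancels the leading singularity,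
  which leaves \<open>O(x\<^sup>2\<^sup>a\<^sup>+\<^sup>1)\<close>. For \<open>a = \<alpha> + 1/2\<close> the exponent is positive exactly when \<open>\<alpha> > -1\<close>.
\<close>

lemma wronskian_tendsto_0:
  fixes f1 f2 g1 g2 :: "real \<Rightarrow> real"
  assumes "a > - 1 / 2"
    and 1: "((\<lambda>x. f1 x / x powr a) \<longlongrightarrow> L1) (at_right 0)"
           "((\<lambda>x. (g1 x - a / x * f1 x) / x powr (a + 1)) \<longlongrightarrow> M1) (at_right 0)"
    and 2: "((\<lambda>x. f2 x / x powr a) \<longlongrightarrow> L2) (at_right 0)"
           "((\<lambda>x. (g2 x - a / x * f2 x) / x powr (a + 1)) \<longlongrightarrow> M2) (at_right 0)"
  shows "((\<lambda>x. f1 x * g2 x - g1 x * f2 x) \<longlongrightarrow> 0) (at_right 0)"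
proof -
  define F where "F = (\<lambda>x. x powr (2 * a + 1) *
     ((f1 x / x powr a) * ((g2 x - a / x * f2 x) / x powr (a + 1))
      - ((g1 x - a / x * f1 x) / x powr (a + 1)) * (f2 x / x powr a)))"
  have "((\<lambda>x. x powr (2 * a + 1)) \<longlongrightarrow> 0) (at_right 0)"
    using assms(1) by real_asymp
  then have "(F \<longlongrightarrow> 0 * (L1 * M2 - M1 * L2)) (at_right 0)"
    unfolding F_def by (intro tendsto_intros 1 2)
  moreover have "\<forall>\<^sub>F x in at_right 0. F x = f1 x * g2 x - g1 x * f2 x"
    using eventually_at_right_less[of "0::real"]
  proof eventually_elim
    case (elim x)
    have *: "x powr (2 * a + 1) = x powr a * x powr (a + 1)"
      by (simp add: powr_add[symmetric])
    have "x powr a > 0" "x powr (a + 1) > 0" using elim by auto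
    then show ?case unfolding F_def * by (simp add: field_simps)
  qed
  ultimately show ?thesis by (simp add: tendsto_cong)
qed

text \<open>
  The logarithmic derivative of the weight is \<open>a/\<theta> + O(\<theta>)\<close>, and the polynomial is a function of
  \<open>sin\<^sup>2(\<theta>/2)\<close>, so its derivative is \<open>O(\<theta>)\<close>; hence the second quotient has a limit as well.
\<close>

lemma liouville_near_0:
  fixes \<alpha> \<beta> :: real
  defines "a \<equiv> \<alpha> + 1 / 2"
  obtains L M where
    "((\<lambda>\<theta>. liouville \<alpha> \<beta> Y \<theta> / \<theta> powr a) \<longlongrightarrow> L) (at_right 0)"
    "((\<lambda>\<theta>. (liouville' \<alpha> \<beta> Y \<theta> - a / \<theta> * liouville \<alpha> \<beta> Y \<theta>) / \<theta> powr (a + 1)) \<longlongrightarrow> M) (at_right 0)"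
proof -
  have sin0: "((\<lambda>\<theta>. (sin (\<theta> / 2))\<^sup>2) \<longlongrightarrow> 0) (at_right (0::real))" by real_asymp
  have Y0: "((\<lambda>\<theta>. poly p ((sin (\<theta> / 2))\<^sup>2)) \<longlongrightarrow> poly p 0) (at_right 0)" for p :: "real poly"
    by (rule isCont_tendsto_compose[OF _ sin0]) simp
  have w: "((\<lambda>\<theta>. (sin (\<theta> / 2) / \<theta>) powr a * cos (\<theta> / 2) powr (\<beta> + 1 / 2)) \<longlongrightarrow> (1 / 2) powr a * 1 powr (\<beta> + 1 / 2)) (at_right 0)"
  proof (intro tendsto_mult tendsto_powr tendsto_const)
    show "((\<lambda>x::real. sin (x / 2) / x) \<longlongrightarrow> 1 / 2) (at_right 0)" by real_asymp
    show "((\<lambda>x::real. cos (x / 2)) \<longlongrightarrow> 1) (at_right 0)" by real_asymp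
  qed auto
  have small: "\<forall>\<^sub>F \<theta> in at_right (0::real). 0 < \<theta> \<and> \<theta> < pi"
    using eventually_at_right_real[OF pi_gt_zero] by simp
  have weq: "(sin (\<theta> / 2) / \<theta>) powr a * cos (\<theta> / 2) powr (\<beta> + 1 / 2) = liouville_weight \<alpha> \<beta> \<theta> / \<theta> powr a"
    if "0 < \<theta>" "\<theta> < pi" for \<theta>
    using that by (simp add: liouville_weight_def a_def powr_divide sin_ge_zero)
  define m where "m \<theta> = a * ((1 / 2 * (cos (\<theta> / 2) / sin (\<theta> / 2)) - 1 / \<theta>) / \<theta>)
              - (\<beta> + 1 / 2) / 2 * (sin (\<theta> / 2) / cos (\<theta> / 2) / \<theta>)" for \<theta>
  have m: "(m \<longlongrightarrow> a * (- 1 / 12) - (\<beta> + 1 / 2) / 2 * (1 / 2)) (at_right 0)"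
    unfolding m_def
  proof (intro tendsto_diff tendsto_mult tendsto_const)
    show "((\<lambda>x::real. (1 / 2 * (cos (x / 2) / sin (x / 2)) - 1 / x) / x) \<longlongrightarrow> - 1 / 12) (at_right 0)"
      by real_asymp
    show "((\<lambda>x::real. sin (x / 2) / cos (x / 2) / x) \<longlongrightarrow> 1 / 2) (at_right 0)" by real_asymp
  qed
  have meq: "m \<theta> = (liouville_logderiv \<alpha> \<beta> \<theta> - a / \<theta>) / \<theta>" if "0 < \<theta>" for \<theta>
  proof -
    have "liouville_logderiv \<alpha> \<beta> \<theta> =
            a / 2 * (cos (\<theta> / 2) / sin (\<theta> / 2)) - (\<beta> + 1 / 2) / 2 * (sin (\<theta> / 2) / cos (\<theta> / 2))"
      by (simp add: liouville_logderiv_def a_def)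
    then show ?thesis by (simp only: m_def) (simp add: diff_divide_distrib right_diff_distrib)
  qed
  have sc: "((\<lambda>\<theta>::real. sin (\<theta> / 2) * cos (\<theta> / 2) / \<theta>) \<longlongrightarrow> 1 / 2) (at_right 0)" by real_asymp
  show ?thesis
  proof (rule that)
    show "((\<lambda>\<theta>. liouville \<alpha> \<beta> Y \<theta> / \<theta> powr a) \<longlongrightarrow> (1 / 2) powr a * 1 powr (\<beta> + 1 / 2) * poly Y 0) (at_right 0)"
      by (rule Lim_transform_eventually[OF tendsto_mult[OF w Y0]])
         (use small in eventually_elim, simp only: weq, simp add: liouville_def)
    show "((\<lambda>\<theta>. (liouville' \<alpha> \<beta> Y \<theta> - a / \<theta> * liouville \<alpha> \<beta> Y \<theta>) / \<theta> powr (a + 1)) \<longlongrightarrow>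
       ((1 / 2) powr a * 1 powr (\<beta> + 1 / 2)) * (poly (pderiv Y) 0 * (1 / 2) + (a * (- 1 / 12) - (\<beta> + 1 / 2) / 2 * (1 / 2)) * poly Y 0)) (at_right 0)"
    proof (rule Lim_transform_eventually[OF tendsto_mult[OF w tendsto_add[OF tendsto_mult[OF Y0 sc] tendsto_mult[OF m Y0]]]])
      show "\<forall>\<^sub>F \<theta> in at_right 0. (sin (\<theta> / 2) / \<theta>) powr a * cos (\<theta> / 2) powr (\<beta> + 1 / 2) *
           (poly (pderiv Y) ((sin (\<theta> / 2))\<^sup>2) * (sin (\<theta> / 2) * cos (\<theta> / 2) / \<theta>) + m \<theta> * poly Y ((sin (\<theta> / 2))\<^sup>2))
         = (liouville' \<alpha> \<beta> Y \<theta> - a / \<theta> * liouville \<alpha> \<beta> Y \<theta>) / \<theta> powr (a + 1)"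
        using small
      proof eventually_elim
        case (elim \<theta>)
        then have t: "0 < \<theta>" "\<theta> < pi" by auto
        show ?case
          unfolding weq[OF t] meq[OF t(1)] liouville_def liouville'_def
          using t by (simp add: powr_add field_simps)
      qed
    qed
  qed
qed

section \<open>Rescaling by the degree\<close>

lemma jacobi_gamma_gt: "\<alpha> > - 1 \<Longrightarrow> \<beta> > - 1 \<Longrightarrow> jacobi_gamma \<alpha> \<beta> n > real n - 1 / 2"
  by (simp add: jacobi_gamma_def jacobi_rho_def field_simps)

definition scaled :: "real \<Rightarrow> real \<Rightarrow> nat \<Rightarrow> real poly \<Rightarrow> real \<Rightarrow> real" where
  "scaled \<alpha> \<beta> n Y x = liouville \<alpha> \<beta> Y (x / jacobi_gamma \<alpha> \<beta> n)"

definition scaled' :: "real \<Rightarrow> real \<Rightarrow> nat \<Rightarrow> real poly \<Rightarrow> real \<Rightarrow> real" where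
  "scaled' \<alpha> \<beta> n Y x = liouville' \<alpha> \<beta> Y (x / jacobi_gamma \<alpha> \<beta> n) / jacobi_gamma \<alpha> \<beta> n"

definition scaled_potential :: "real \<Rightarrow> real \<Rightarrow> nat \<Rightarrow> real \<Rightarrow> real" where
  "scaled_potential \<alpha> \<beta> n x =
     1 + (4 * jacobi_A \<alpha> + potential_excess \<alpha> \<beta> (x / jacobi_gamma \<alpha> \<beta> n)) / x\<^sup>2"

lemma DERIV_scaled:
  assumes "jacobi_gamma \<alpha> \<beta> n > 0" "0 < x" "x < pi * jacobi_gamma \<alpha> \<beta> n"
  shows "(scaled \<alpha> \<beta> n Y has_real_derivative scaled' \<alpha> \<beta> n Y x) (at x)"
proof -
  let ?g = "jacobi_gamma \<alpha> \<beta> n"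
  have "0 < x / ?g" "x / ?g < pi" using assms by (auto simp: field_simps)
  from DERIV_chain2[OF DERIV_liouville[OF this] DERIV_cdivide[OF DERIV_ident]]
  show ?thesis by (simp add: scaled_def[abs_def] scaled'_def)
qed

lemma DERIV_scaled':
  assumes "jacobi_solution \<alpha> \<beta> n Y" "jacobi_gamma \<alpha> \<beta> n > 0" "0 < x" "x < pi * jacobi_gamma \<alpha> \<beta> n"
  shows "(scaled' \<alpha> \<beta> n Y has_real_derivative - scaled_potential \<alpha> \<beta> n x * scaled \<alpha> \<beta> n Y x) (at x)"
proof -
  let ?g = "jacobi_gamma \<alpha> \<beta> n"
  have *: "0 < x / ?g" "x / ?g < pi" using assms by (auto simp: field_simps)
  have "- scaled_potential \<alpha> \<beta> n x * scaled \<alpha> \<beta> n Y x =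
     - (?g\<^sup>2 + (4 * jacobi_A \<alpha> + potential_excess \<alpha> \<beta> (x / ?g)) / (x / ?g)\<^sup>2)
            * liouville \<alpha> \<beta> Y (x / ?g) * (1 / ?g) / ?g"
    using assms(2,3) by (simp add: scaled_potential_def scaled_def field_simps power2_eq_square)
  with DERIV_cdivide[OF DERIV_chain2[OF DERIV_liouville'[OF * assms(1)] DERIV_cdivide[OF DERIV_ident]], of ?g]
  show ?thesis by (simp only: scaled'_def[abs_def])
qed

lemma scaled_near_0:
  fixes \<alpha> \<beta> :: real
  assumes g: "jacobi_gamma \<alpha> \<beta> n > 0"
  defines "a \<equiv> \<alpha> + 1 / 2"
  obtains L M where
    "((\<lambda>x. scaled \<alpha> \<beta> n Y x / x powr a) \<longlongrightarrow> L) (at_right 0)"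
    "((\<lambda>x. (scaled' \<alpha> \<beta> n Y x - a / x * scaled \<alpha> \<beta> n Y x) / x powr (a + 1)) \<longlongrightarrow> M) (at_right 0)"
proof -
  define g where "g = jacobi_gamma \<alpha> \<beta> n"
  have g: "g > 0" using assms by (simp add: g_def)
  obtain L M where
    L: "((\<lambda>\<theta>. liouville \<alpha> \<beta> Y \<theta> / \<theta> powr a) \<longlongrightarrow> L) (at_right 0)" and
    M: "((\<lambda>\<theta>. (liouville' \<alpha> \<beta> Y \<theta> - a / \<theta> * liouville \<alpha> \<beta> Y \<theta>) / \<theta> powr (a + 1)) \<longlongrightarrow> M) (at_right 0)"
    unfolding a_def using liouville_near_0 by blast
  have lim: "filterlim (\<lambda>x. x / g) (at_right 0) (at_right 0)"
    using g by real_asymp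
  have pos: "\<forall>\<^sub>F x in at_right (0::real). 0 < x" by (rule eventually_at_right_less)
  show ?thesis
  proof (rule that)
    show "((\<lambda>x. scaled \<alpha> \<beta> n Y x / x powr a) \<longlongrightarrow> L / g powr a) (at_right 0)"
    proof (rule Lim_transform_eventually[OF tendsto_divide[OF filterlim_compose[OF L lim] tendsto_const]])
      show "\<forall>\<^sub>F x in at_right 0. liouville \<alpha> \<beta> Y (x / g) / (x / g) powr a / g powr a = scaled \<alpha> \<beta> n Y x / x powr a"
        using pos by eventually_elim (use g in \<open>simp add: scaled_def g_def[symmetric] powr_divide\<close>)
    qed (use g in auto)
    show "((\<lambda>x. (scaled' \<alpha> \<beta> n Y x - a / x * scaled \<alpha> \<beta> n Y x) / x powr (a + 1)) \<longlongrightarrow> M / g powr (a + 1) / g) (at_right 0)"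
    proof (rule Lim_transform_eventually[OF tendsto_divide[OF tendsto_divide[OF filterlim_compose[OF M lim] tendsto_const] tendsto_const]])
      show "\<forall>\<^sub>F x in at_right 0. (liouville' \<alpha> \<beta> Y (x / g) - a / (x / g) * liouville \<alpha> \<beta> Y (x / g)) / (x / g) powr (a + 1) / g powr (a + 1) / g
           = (scaled' \<alpha> \<beta> n Y x - a / x * scaled \<alpha> \<beta> n Y x) / x powr (a + 1)"
        using pos by eventually_elim (use g in \<open>simp add: scaled_def scaled'_def g_def[symmetric] powr_divide diff_divide_distrib\<close>)
    qed (use g in auto)
  qed
qed

lemma liouville_weight_pos: "0 < \<theta> \<Longrightarrow> \<theta> < pi \<Longrightarrow> liouville_weight \<alpha> \<beta> \<theta> > 0"
  using sin_gt_zero[of "\<theta> / 2"] cos_gt_zero[of "\<theta> / 2"] by (simp add: liouville_weight_def)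

lemma scaled_eq_0_iff:
  assumes "jacobi_gamma \<alpha> \<beta> n > 0" "0 < x" "x < pi * jacobi_gamma \<alpha> \<beta> n"
  shows "scaled \<alpha> \<beta> n Y x = 0 \<longleftrightarrow> x / jacobi_gamma \<alpha> \<beta> n \<in> zero_angles Y"
proof -
  have "0 < x / jacobi_gamma \<alpha> \<beta> n" "x / jacobi_gamma \<alpha> \<beta> n < pi"
    using assms by (auto simp: field_simps)
  then show ?thesis
    using liouville_weight_pos[of "x / jacobi_gamma \<alpha> \<beta> n" \<alpha> \<beta>]
    by (auto simp: scaled_def liouville_def zero_angles_def)
qed

definition scaled_zero :: "real \<Rightarrow> real \<Rightarrow> nat \<Rightarrow> real poly \<Rightarrow> nat \<Rightarrow> real" where
  "scaled_zero \<alpha> \<beta> n Y k = jacobi_gamma \<alpha> \<beta> n * zero_angle Y k"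

lemma jacobi_gamma_pos: "\<alpha> > - 1 \<Longrightarrow> \<beta> > - 1 \<Longrightarrow> n \<ge> 1 \<Longrightarrow> jacobi_gamma \<alpha> \<beta> n > 0"
  using jacobi_gamma_gt[of \<alpha> \<beta> n] by simp

lemma jacobi_gamma_large:
  assumes "\<alpha> > - 1" "\<beta> > - 1" "c > 0"
  obtains N where "N \<ge> 2" "\<And>n. n \<ge> N \<Longrightarrow> X < c * jacobi_gamma \<alpha> \<beta> n"
proof -
  obtain N :: nat where N: "real N > X / c + 1" using reals_Archimedean2 by blast
  have "X < c * jacobi_gamma \<alpha> \<beta> n" if "n \<ge> max N 2" for n
  proof -
    have "X / c < jacobi_gamma \<alpha> \<beta> n"
      using jacobi_gamma_gt[OF assms(1,2), of n] N that by auto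
    then show ?thesis using assms(3) by (simp add: field_simps)
  qed
  then show ?thesis using that[of "max N 2"] by simp
qed

lemma scaled_first_zero:
  assumes "jacobi_solution \<alpha> \<beta> n Y" "n \<ge> 1" and g: "jacobi_gamma \<alpha> \<beta> n > 0"
  shows "0 < scaled_zero \<alpha> \<beta> n Y 1" "scaled_zero \<alpha> \<beta> n Y 1 < pi * jacobi_gamma \<alpha> \<beta> n"
    "scaled \<alpha> \<beta> n Y (scaled_zero \<alpha> \<beta> n Y 1) = 0"
    "\<And>x. 0 < x \<Longrightarrow> x < scaled_zero \<alpha> \<beta> n Y 1 \<Longrightarrow> scaled \<alpha> \<beta> n Y x > 0"
proof -
  define g where "g = jacobi_gamma \<alpha> \<beta> n"
  have g: "g > 0" using assms by (simp add: g_def)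
  note z = zero_angle_first[OF assms(1,2)]
  show s: "0 < scaled_zero \<alpha> \<beta> n Y 1" "scaled_zero \<alpha> \<beta> n Y 1 < pi * jacobi_gamma \<alpha> \<beta> n"
    using z g by (auto simp: scaled_zero_def g_def mult.commute)
  show "scaled \<alpha> \<beta> n Y (scaled_zero \<alpha> \<beta> n Y 1) = 0"
    using z g by (subst scaled_eq_0_iff[OF assms(3) s]) (auto simp: scaled_zero_def g_def)
  fix x assume x: "0 < x" "x < scaled_zero \<alpha> \<beta> n Y 1"
  define \<theta> where "\<theta> = x / g"
  have t: "0 < \<theta>" "\<theta> < zero_angle Y 1"
    using x g by (auto simp: \<theta>_def scaled_zero_def g_def[symmetric] field_simps)
  have "poly Y ((sin (\<theta> / 2))\<^sup>2) > 0"
  proof (rule ccontr)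
    assume "\<not> poly Y ((sin (\<theta> / 2))\<^sup>2) > 0"
    moreover have "poly Y ((sin (0 / 2))\<^sup>2) > 0" using assms(1) by (simp add: jacobi_solution_def)
    ultimately obtain \<phi> where p: "0 \<le> \<phi>" "\<phi> \<le> \<theta>" "poly Y ((sin (\<phi> / 2))\<^sup>2) = 0"
      using IVT2'[of "\<lambda>\<theta>. poly Y ((sin (\<theta> / 2))\<^sup>2)" \<theta> 0 0] t
      by (fastforce intro!: continuous_intros)
    then have "\<phi> \<noteq> 0" using \<open>poly Y ((sin (0 / 2))\<^sup>2) > 0\<close> by auto
    then have "\<phi> \<in> zero_angles Y" using p t z(2) by (auto simp: zero_angles_def)
    from z(4)[OF this] p t show False by simp
  qed
  then show "scaled \<alpha> \<beta> n Y x > 0"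
    using liouville_weight_pos[of \<theta>] t z(2)
    by (simp add: scaled_def liouville_def \<theta>_def[symmetric] g_def[symmetric])
qed

lemma scaled_second_zero:
  assumes "jacobi_solution \<alpha> \<beta> n Y" "n \<ge> 2" and g: "jacobi_gamma \<alpha> \<beta> n > 0"
  shows "scaled_zero \<alpha> \<beta> n Y 1 < scaled_zero \<alpha> \<beta> n Y 2"
    "scaled_zero \<alpha> \<beta> n Y 2 < pi * jacobi_gamma \<alpha> \<beta> n"
    "scaled \<alpha> \<beta> n Y (scaled_zero \<alpha> \<beta> n Y 2) = 0"
    "\<And>x. scaled_zero \<alpha> \<beta> n Y 1 < x \<Longrightarrow> x < scaled_zero \<alpha> \<beta> n Y 2 \<Longrightarrow> scaled \<alpha> \<beta> n Y x \<noteq> 0"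
proof -
  have n1: "n \<ge> 1" using assms by simp
  note z = zero_angle_second[OF assms(1,2)]
  note f = scaled_first_zero[OF assms(1) n1 g]
  show s: "scaled_zero \<alpha> \<beta> n Y 1 < scaled_zero \<alpha> \<beta> n Y 2"
    "scaled_zero \<alpha> \<beta> n Y 2 < pi * jacobi_gamma \<alpha> \<beta> n"
    using z g by (auto simp: scaled_zero_def mult.commute)
  show "scaled \<alpha> \<beta> n Y (scaled_zero \<alpha> \<beta> n Y 2) = 0"
    using z g scaled_eq_0_iff[OF g less_trans[OF f(1) s(1)] s(2)] by (simp add: scaled_zero_def)
  fix x assume x: "scaled_zero \<alpha> \<beta> n Y 1 < x" "x < scaled_zero \<alpha> \<beta> n Y 2"
  then have "zero_angle Y 1 < x / jacobi_gamma \<alpha> \<beta> n" "x / jacobi_gamma \<alpha> \<beta> n < zero_angle Y 2"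
    using g by (auto simp: scaled_zero_def field_simps)
  then have "x / jacobi_gamma \<alpha> \<beta> n \<notin> zero_angles Y" using z(4) by force
  then show "scaled \<alpha> \<beta> n Y x \<noteq> 0"
    using scaled_eq_0_iff[OF g, of x Y] f(1) s x by auto
qed

section \<open>Comparison of the rescaled zeros\<close>

lemma nonzero_imp_one_signed:
  fixes f :: "real \<Rightarrow> real"
  assumes "a < b" "continuous_on {a<..<b} f" "\<And>x. a < x \<Longrightarrow> x < b \<Longrightarrow> f x \<noteq> 0"
  obtains \<sigma> :: real where "\<And>x. a < x \<Longrightarrow> x < b \<Longrightarrow> \<sigma> * f x > 0"
proof -
  define c where "c = (a + b) / 2"
  have c: "a < c" "c < b" using assms(1) by (auto simp: c_def)
  have "f c * f x > 0" if x: "a < x" "x < b" for x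
  proof (rule ccontr)
    assume "\<not> f c * f x > 0"
    moreover have "f c \<noteq> 0" "f x \<noteq> 0" using assms(3) c x by auto
    ultimately have "f c < 0 \<and> 0 < f x \<or> f x < 0 \<and> 0 < f c"
      by (auto simp: zero_less_mult_iff not_less)
    moreover have "connected (f ` {a<..<b})"
      by (intro connected_continuous_image assms(2)) simp
    moreover have "f c \<in> f ` {a<..<b}" "f x \<in> f ` {a<..<b}" using c x by auto
    ultimately have "0 \<in> f ` {a<..<b}"
      unfolding connected_iff_interval by (metis less_imp_le)
    then show False using assms(3) by force
  qed
  then show ?thesis using that by blast
qed

text \<open>
  A larger potential makes the first zero come earlier. The comparison starts at the singular point
  \<open>0\<close>, where the Wronskian vanishes since both solutions have the exponent \<open>\<alpha> + 1/2\<close>.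
\<close>

lemma scaled_first_zero_less:
  assumes "\<alpha> > - 1" and "n \<ge> 1" "m \<ge> 1"
    and Y: "jacobi_solution \<alpha> \<beta> n Y" "jacobi_gamma \<alpha> \<beta> n > 0"
    and Z: "jacobi_solution \<alpha> \<beta> m Z" "jacobi_gamma \<alpha> \<beta> m > 0"
    and H: "\<And>x. 0 < x \<Longrightarrow> x < scaled_zero \<alpha> \<beta> m Z 1 \<Longrightarrow>
        potential_excess \<alpha> \<beta> (x / jacobi_gamma \<alpha> \<beta> m) < potential_excess \<alpha> \<beta> (x / jacobi_gamma \<alpha> \<beta> n)"
  shows "scaled_zero \<alpha> \<beta> n Y 1 < scaled_zero \<alpha> \<beta> m Z 1"
proof (rule ccontr)
  define b where "b = scaled_zero \<alpha> \<beta> m Z 1"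
  assume "\<not> ?thesis"
  then have le: "b \<le> scaled_zero \<alpha> \<beta> n Y 1" by (simp add: b_def)
  note fY = scaled_first_zero[OF Y(1) assms(2) Y(2)]
  note fZ = scaled_first_zero[OF Z(1) assms(3) Z(2), folded b_def]
  obtain L1 M1 where limY:
    "((\<lambda>x. scaled \<alpha> \<beta> n Y x / x powr (\<alpha> + 1 / 2)) \<longlongrightarrow> L1) (at_right 0)"
    "((\<lambda>x. (scaled' \<alpha> \<beta> n Y x - (\<alpha> + 1 / 2) / x * scaled \<alpha> \<beta> n Y x) / x powr (\<alpha> + 1 / 2 + 1)) \<longlongrightarrow> M1) (at_right 0)"
    by (rule scaled_near_0[OF Y(2)])
  obtain L2 M2 where limZ:
    "((\<lambda>x. scaled \<alpha> \<beta> m Z x / x powr (\<alpha> + 1 / 2)) \<longlongrightarrow> L2) (at_right 0)"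
    "((\<lambda>x. (scaled' \<alpha> \<beta> m Z x - (\<alpha> + 1 / 2) / x * scaled \<alpha> \<beta> m Z x) / x powr (\<alpha> + 1 / 2 + 1)) \<longlongrightarrow> M2) (at_right 0)"
    by (rule scaled_near_0[OF Z(2)])
  have "scaled \<alpha> \<beta> m Z b \<noteq> 0"
  proof (rule sturm_comparison[of 0 b "scaled \<alpha> \<beta> n Y" "scaled' \<alpha> \<beta> n Y" "scaled_potential \<alpha> \<beta> n"
        "scaled \<alpha> \<beta> m Z" "scaled' \<alpha> \<beta> m Z" "scaled_potential \<alpha> \<beta> m" 0])
    show "0 < b" by (rule fZ)
    fix x assume x: "0 < x" "x \<le> b"
    then have xn: "x < pi * jacobi_gamma \<alpha> \<beta> n" and xm: "x < pi * jacobi_gamma \<alpha> \<beta> m"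
      using le fY(2) fZ(2) by auto
    show "(scaled \<alpha> \<beta> n Y has_real_derivative scaled' \<alpha> \<beta> n Y x) (at x)"
      "(scaled' \<alpha> \<beta> n Y has_real_derivative - scaled_potential \<alpha> \<beta> n x * scaled \<alpha> \<beta> n Y x) (at x)"
      "(scaled \<alpha> \<beta> m Z has_real_derivative scaled' \<alpha> \<beta> m Z x) (at x)"
      "(scaled' \<alpha> \<beta> m Z has_real_derivative - scaled_potential \<alpha> \<beta> m x * scaled \<alpha> \<beta> m Z x) (at x)"
      by (rule DERIV_scaled[OF Y(2) x(1) xn] DERIV_scaled'[OF Y x(1) xn]
               DERIV_scaled[OF Z(2) x(1) xm] DERIV_scaled'[OF Z x(1) xm])+
  next
    fix x assume x: "0 < x" "x < b"
    then show "scaled_potential \<alpha> \<beta> m x < scaled_potential \<alpha> \<beta> n x"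
      using H[of x] by (simp add: scaled_potential_def b_def divide_strict_right_mono)
    show "0 < scaled \<alpha> \<beta> n Y x" "0 < scaled \<alpha> \<beta> m Z x"
      using x le fY(4) fZ(4) by auto
  next
    show "((\<lambda>x. scaled \<alpha> \<beta> n Y x * scaled' \<alpha> \<beta> m Z x - scaled' \<alpha> \<beta> n Y x * scaled \<alpha> \<beta> m Z x) \<longlongrightarrow> 0) (at_right 0)"
      using assms(1) by (intro wronskian_tendsto_0[OF _ limY limZ]) simp
  qed simp
  then show False using fZ(3) by simp
qed

lemma potential_excess_small:
  assumes "\<epsilon> > 0"
  obtains \<delta> where "0 < \<delta>" "\<And>\<theta>. 0 < \<theta> \<Longrightarrow> \<theta> \<le> \<delta> \<Longrightarrow> \<bar>potential_excess \<alpha> \<beta> \<theta>\<bar> < \<epsilon>"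
proof -
  have "\<forall>\<^sub>F \<theta> in at_right 0. \<bar>potential_excess \<alpha> \<beta> \<theta>\<bar> < \<epsilon>"
    using tendstoD[OF potential_excess_tendsto_0 assms] by simp
  then obtain d where d: "d > 0" "\<And>x. 0 < x \<Longrightarrow> x < d \<Longrightarrow> \<bar>potential_excess \<alpha> \<beta> x\<bar> < \<epsilon>"
    unfolding eventually_at_right_field by auto
  show ?thesis
    by (rule that[of "d / 2"]) (use d in auto)
qed

text \<open>
  Beyond some \<open>X\<^sub>0\<close> that does not depend on \<open>n\<close>, the potential exceeds \<open>1/4\<close>, so a zero must occur before
  the half-wave of \<open>sin((x - X\<^sub>0)/2)\<close> ends at \<open>X\<^sub>0 + 2\<pi>\<close>.
\<close>

lemma scaled_first_zero_bounded:
  assumes "\<alpha> > - 1" "\<beta> > - 1"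
  obtains X N where "N \<ge> 2"
    "\<And>n Y. n \<ge> N \<Longrightarrow> jacobi_solution \<alpha> \<beta> n Y \<Longrightarrow> scaled_zero \<alpha> \<beta> n Y 1 \<le> X"
proof -
  \<comment> \<open>Chosen such that \<open>(4 \<bar>A\<bar> + 1) / x\<^sup>2 \<le> 1/2\<close> for \<open>x \<ge> X\<^sub>0\<close>, which keeps the potential at least \<open>1/2\<close>.\<close>
  define X0 where "X0 = 4 * \<bar>jacobi_A \<alpha>\<bar> + 2"
  define X where "X = X0 + 2 * pi"
  have X: "0 < X0" "X0 < X" by (auto simp: X0_def X_def add_nonneg_pos)
  obtain \<delta> where \<delta>: "0 < \<delta>" "\<And>\<theta>. 0 < \<theta> \<Longrightarrow> \<theta> \<le> \<delta> \<Longrightarrow> \<bar>potential_excess \<alpha> \<beta> \<theta>\<bar> < 1"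
    by (rule potential_excess_small[of 1]) auto
  obtain N where N: "N \<ge> 2" "\<And>n. n \<ge> N \<Longrightarrow> X < \<delta> * jacobi_gamma \<alpha> \<beta> n"
    using jacobi_gamma_large[OF assms \<delta>(1)] by metis
  have "scaled_zero \<alpha> \<beta> n Y 1 \<le> X" if n: "n \<ge> N" and Y: "jacobi_solution \<alpha> \<beta> n Y" for n Y
  proof (rule ccontr)
    assume "\<not> ?thesis"
    then have gt: "X < scaled_zero \<alpha> \<beta> n Y 1" by simp
    define g where "g = jacobi_gamma \<alpha> \<beta> n"
    have n1: "n \<ge> 1" using n N by simp
    have g: "jacobi_gamma \<alpha> \<beta> n > 0" using jacobi_gamma_pos[OF assms n1] .
    note f = scaled_first_zero[OF Y n1 g]
    have pot: "scaled_potential \<alpha> \<beta> n x > 1 / 4" if x: "X0 < x" "x < X" for x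
    proof -
      have "0 < x / g" "x / g \<le> \<delta>"
        using x X g N(2)[OF n] by (auto simp: g_def field_simps)
      from \<delta>(2)[OF this] have "\<bar>4 * jacobi_A \<alpha> + potential_excess \<alpha> \<beta> (x / g)\<bar> \<le> 4 * \<bar>jacobi_A \<alpha>\<bar> + 1"
        by linarith
      also have "2 * (4 * \<bar>jacobi_A \<alpha>\<bar> + 1) \<le> X0\<^sup>2"
        by (simp add: X0_def power2_eq_square algebra_simps)
      then have "4 * \<bar>jacobi_A \<alpha>\<bar> + 1 \<le> X0\<^sup>2 / 2" by simp
      also have "X0\<^sup>2 / 2 \<le> x\<^sup>2 / 2" using x X by (auto intro: power_mono)
      finally have "\<bar>4 * jacobi_A \<alpha> + potential_excess \<alpha> \<beta> (x / g)\<bar> / x\<^sup>2 \<le> 1 / 2"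
        using x X by (simp add: field_simps)
      then have "\<bar>(4 * jacobi_A \<alpha> + potential_excess \<alpha> \<beta> (x / g)) / x\<^sup>2\<bar> \<le> 1 / 2"
        by (simp add: abs_divide)
      then show ?thesis unfolding scaled_potential_def g_def by linarith
    qed
    have D: "(scaled \<alpha> \<beta> n Y has_real_derivative scaled' \<alpha> \<beta> n Y x) (at x)"
        "(scaled' \<alpha> \<beta> n Y has_real_derivative - scaled_potential \<alpha> \<beta> n x * scaled \<alpha> \<beta> n Y x) (at x)"
      if x: "0 < x" "x \<le> X" for x
    proof -
      have "x < pi * jacobi_gamma \<alpha> \<beta> n" using x gt f(2) by simp
      then show "(scaled \<alpha> \<beta> n Y has_real_derivative scaled' \<alpha> \<beta> n Y x) (at x)"
        "(scaled' \<alpha> \<beta> n Y has_real_derivative - scaled_potential \<alpha> \<beta> n x * scaled \<alpha> \<beta> n Y x) (at x)"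
        by (rule DERIV_scaled[OF g x(1)], rule DERIV_scaled'[OF Y g x(1)])
    qed
    have "sin ((X - X0) / 2) \<noteq> 0"
    proof (rule sturm_comparison[of X0 X "scaled \<alpha> \<beta> n Y" "scaled' \<alpha> \<beta> n Y" "scaled_potential \<alpha> \<beta> n"
          "\<lambda>x. sin ((x - X0) / 2)" "\<lambda>x. cos ((x - X0) / 2) / 2" "\<lambda>_. 1 / 4" "scaled \<alpha> \<beta> n Y X0 / 2"])
      show "0 < sin ((x - X0) / 2)" if "X0 < x" "x < X" for x
        using that by (intro sin_gt_zero) (auto simp: X_def)
      show "((\<lambda>x. sin ((x - X0) / 2)) has_real_derivative cos ((x - X0) / 2) / 2) (at x)"
        "((\<lambda>x. cos ((x - X0) / 2) / 2) has_real_derivative - (1 / 4) * sin ((x - X0) / 2)) (at x)" for x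
        by (auto intro!: derivative_eq_intros)
      have c: "isCont (scaled \<alpha> \<beta> n Y) X0" "isCont (scaled' \<alpha> \<beta> n Y) X0"
        using D[of X0] X by (auto intro: DERIV_isCont)
      have "isCont (\<lambda>x. scaled \<alpha> \<beta> n Y x * (cos ((x - X0) / 2) / 2) - scaled' \<alpha> \<beta> n Y x * sin ((x - X0) / 2)) X0"
        by (intro continuous_intros c) auto
      then have "((\<lambda>x. scaled \<alpha> \<beta> n Y x * (cos ((x - X0) / 2) / 2) - scaled' \<alpha> \<beta> n Y x * sin ((x - X0) / 2))
            \<longlongrightarrow> scaled \<alpha> \<beta> n Y X0 / 2) (at X0)" by (simp add: isCont_def)
      then show "((\<lambda>x. scaled \<alpha> \<beta> n Y x * (cos ((x - X0) / 2) / 2) - scaled' \<alpha> \<beta> n Y x * sin ((x - X0) / 2))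
            \<longlongrightarrow> scaled \<alpha> \<beta> n Y X0 / 2) (at_right X0)" by (rule filterlim_mono) (auto intro: at_le)
      show "0 \<le> scaled \<alpha> \<beta> n Y X0 / 2" using f(4)[of X0] X gt by simp
    qed (use X pot D f(4) gt in auto)
    then show False by (simp add: X_def)
  qed
  then show ?thesis using that[of N X] N X by auto
qed

lemma sgn_scaled_first_zero_diff:
  assumes "\<alpha> > - 1" "\<beta> > - 1" and C: "jacobi_C \<alpha> \<beta> \<noteq> 0"
  obtains N where
    "\<And>n Y Z. n \<ge> N \<Longrightarrow> jacobi_solution \<alpha> \<beta> n Y \<Longrightarrow> jacobi_solution \<alpha> \<beta> (n + 1) Z \<Longrightarrow>
       sgn (scaled_zero \<alpha> \<beta> (n + 1) Z 1 - scaled_zero \<alpha> \<beta> n Y 1) = sgn (jacobi_C \<alpha> \<beta>)"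
proof -
  obtain X N1 where X: "N1 \<ge> 2"
    "\<And>n Y. n \<ge> N1 \<Longrightarrow> jacobi_solution \<alpha> \<beta> n Y \<Longrightarrow> scaled_zero \<alpha> \<beta> n Y 1 \<le> X"
    using scaled_first_zero_bounded[OF assms(1,2)] by metis
  obtain \<delta> where \<delta>: "\<delta> > 0" "\<And>x y. 0 < x \<Longrightarrow> x < y \<Longrightarrow> y < \<delta> \<Longrightarrow>
       sgn (jacobi_C \<alpha> \<beta>) * potential_excess \<alpha> \<beta> x < sgn (jacobi_C \<alpha> \<beta>) * potential_excess \<alpha> \<beta> y"
    using potential_excess_strict_mono[OF C] by metis
  obtain N2 where N2: "\<And>n. n \<ge> N2 \<Longrightarrow> X < \<delta> * jacobi_gamma \<alpha> \<beta> n"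
    using jacobi_gamma_large[OF assms(1,2) \<delta>(1)] by metis
  show ?thesis
  proof (rule that[of "max N1 N2"])
    fix n Y Z assume n: "max N1 N2 \<le> n"
      and Y: "jacobi_solution \<alpha> \<beta> n Y" and Z: "jacobi_solution \<alpha> \<beta> (n + 1) Z"
    have n1: "n \<ge> 1" "n + 1 \<ge> 1" using n X by auto
    note g = jacobi_gamma_pos[OF assms(1,2) n1(1)] jacobi_gamma_pos[OF assms(1,2) n1(2)]
    have gg: "jacobi_gamma \<alpha> \<beta> n < jacobi_gamma \<alpha> \<beta> (n + 1)" by (simp add: jacobi_gamma_def)
    have H: "sgn (jacobi_C \<alpha> \<beta>) * potential_excess \<alpha> \<beta> (x / jacobi_gamma \<alpha> \<beta> (n + 1))
        < sgn (jacobi_C \<alpha> \<beta>) * potential_excess \<alpha> \<beta> (x / jacobi_gamma \<alpha> \<beta> n)"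
      if x: "0 < x" "x < X" for x
    proof (rule \<delta>(2))
      show "0 < x / jacobi_gamma \<alpha> \<beta> (n + 1)" using x g by simp
      show "x / jacobi_gamma \<alpha> \<beta> (n + 1) < x / jacobi_gamma \<alpha> \<beta> n"
        using x g gg by (intro divide_strict_left_mono) auto
      show "x / jacobi_gamma \<alpha> \<beta> n < \<delta>" using N2[of n] n x g by (simp add: field_simps)
    qed
    have le: "scaled_zero \<alpha> \<beta> n Y 1 \<le> X" "scaled_zero \<alpha> \<beta> (n + 1) Z 1 \<le> X"
      using X(2)[OF _ Y] X(2)[OF _ Z] n by auto
    consider "jacobi_C \<alpha> \<beta> > 0" | "jacobi_C \<alpha> \<beta> < 0" using C by linarith
    then show "sgn (scaled_zero \<alpha> \<beta> (n + 1) Z 1 - scaled_zero \<alpha> \<beta> n Y 1) = sgn (jacobi_C \<alpha> \<beta>)"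
    proof cases
      case 1
      have "scaled_zero \<alpha> \<beta> n Y 1 < scaled_zero \<alpha> \<beta> (n + 1) Z 1"
        by (rule scaled_first_zero_less[OF assms(1) n1 Y g(1) Z g(2)]) (use H le 1 in auto)
      with 1 show ?thesis by simp
    next
      case 2
      have "scaled_zero \<alpha> \<beta> (n + 1) Z 1 < scaled_zero \<alpha> \<beta> n Y 1"
        by (rule scaled_first_zero_less[OF assms(1) n1(2,1) Z g(2) Y g(1)]) (use H le 2 in auto)
      with 2 show ?thesis by simp
    qed
  qed
qed

text \<open>
  For bounded \<open>x\<close> and large \<open>n\<close>, the numerator \<open>4A + H(x/\<gamma>\<^sub>n)\<close> has the sign of \<open>A\<close>, so the potential is
  compared with the constant \<open>1\<close>, whose solution \<open>sin(x - y\<^sub>1)\<close> has the next zero at \<open>y\<^sub>1 + \<pi>\<close>.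
\<close>

lemma sgn_pi_minus_scaled_zero_gap:
  assumes "\<alpha> > - 1" "\<beta> > - 1" and A: "jacobi_A \<alpha> \<noteq> 0"
  obtains N where
    "\<And>n Y. n \<ge> N \<Longrightarrow> jacobi_solution \<alpha> \<beta> n Y \<Longrightarrow>
       sgn (pi - (scaled_zero \<alpha> \<beta> n Y 2 - scaled_zero \<alpha> \<beta> n Y 1)) = sgn (jacobi_A \<alpha>)"
proof -
  obtain X N1 where X: "N1 \<ge> 2"
    "\<And>n Y. n \<ge> N1 \<Longrightarrow> jacobi_solution \<alpha> \<beta> n Y \<Longrightarrow> scaled_zero \<alpha> \<beta> n Y 1 \<le> X"
    using scaled_first_zero_bounded[OF assms(1,2)] by metis
  obtain \<delta> where \<delta>: "0 < \<delta>"
    "\<And>\<theta>. 0 < \<theta> \<Longrightarrow> \<theta> \<le> \<delta> \<Longrightarrow> \<bar>potential_excess \<alpha> \<beta> \<theta>\<bar> < 4 * \<bar>jacobi_A \<alpha>\<bar>"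
    using potential_excess_small[of "4 * \<bar>jacobi_A \<alpha>\<bar>"] A by auto
  \<comment> \<open>The comparison extends at most \<open>\<pi>\<close> beyond the first zero.\<close>
  obtain N2 where N2: "\<And>n. n \<ge> N2 \<Longrightarrow> X + pi < \<delta> * jacobi_gamma \<alpha> \<beta> n"
    using jacobi_gamma_large[OF assms(1,2) \<delta>(1)] by metis
  show ?thesis
  proof (rule that[of "max N1 N2"])
    fix n Y assume n: "max N1 N2 \<le> n" and Y: "jacobi_solution \<alpha> \<beta> n Y"
    have n2: "n \<ge> 2" "n \<ge> 1" using n X by auto
    define g where "g = jacobi_gamma \<alpha> \<beta> n"
    have g: "jacobi_gamma \<alpha> \<beta> n > 0" using jacobi_gamma_pos[OF assms(1,2) n2(2)] .
    define y1 y2 where "y1 = scaled_zero \<alpha> \<beta> n Y 1" and "y2 = scaled_zero \<alpha> \<beta> n Y 2"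
    note f1 = scaled_first_zero[OF Y n2(2) g, folded y1_def]
    note f2 = scaled_second_zero[OF Y n2(1) g, folded y1_def y2_def]
    have y1: "y1 \<le> X" using X(2)[OF _ Y] n by (simp add: y1_def)
    have small: "\<bar>potential_excess \<alpha> \<beta> (x / g)\<bar> < 4 * \<bar>jacobi_A \<alpha>\<bar>" if "0 < x" "x \<le> X + pi" for x
      using that g N2[of n] n by (intro \<delta>(2)) (auto simp: g_def field_simps)
    have D: "(scaled \<alpha> \<beta> n Y has_real_derivative scaled' \<alpha> \<beta> n Y x) (at x)"
        "(scaled' \<alpha> \<beta> n Y has_real_derivative - scaled_potential \<alpha> \<beta> n x * scaled \<alpha> \<beta> n Y x) (at x)"
      if x: "0 < x" "x \<le> y2" for x
    proof -
      have "x < pi * jacobi_gamma \<alpha> \<beta> n" using x f2(2) by simp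
      then show "(scaled \<alpha> \<beta> n Y has_real_derivative scaled' \<alpha> \<beta> n Y x) (at x)"
        "(scaled' \<alpha> \<beta> n Y has_real_derivative - scaled_potential \<alpha> \<beta> n x * scaled \<alpha> \<beta> n Y x) (at x)"
        by (rule DERIV_scaled[OF g x(1)], rule DERIV_scaled'[OF Y g x(1)])
    qed
    have "continuous_on {y1<..<y2} (scaled \<alpha> \<beta> n Y)"
      using f1(1) by (intro continuous_at_imp_continuous_on ballI DERIV_isCont[OF D(1)]) auto
    from nonzero_imp_one_signed[OF f2(1) this f2(4)]
    obtain \<sigma> where \<sigma>: "\<And>x. y1 < x \<Longrightarrow> x < y2 \<Longrightarrow> \<sigma> * scaled \<alpha> \<beta> n Y x > 0" by blast
    \<comment> \<open>The sign of the solution between its first two zeros is immaterial, so it is normalised to be positive.\<close>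
    define v v' where "v x = \<sigma> * scaled \<alpha> \<beta> n Y x" and "v' x = \<sigma> * scaled' \<alpha> \<beta> n Y x" for x
    have Dv: "(v has_real_derivative v' x) (at x)"
        "(v' has_real_derivative - scaled_potential \<alpha> \<beta> n x * v x) (at x)"
      if x: "y1 < x" "x \<le> y2" for x
    proof -
      have "0 < x" using x f1(1) by simp
      then show "(v has_real_derivative v' x) (at x)"
        "(v' has_real_derivative - scaled_potential \<alpha> \<beta> n x * v x) (at x)"
        unfolding v_def[abs_def] v'_def[abs_def]
        using DERIV_cmult[OF D(1)[OF _ x(2)], of \<sigma>] DERIV_cmult[OF D(2)[OF _ x(2)], of \<sigma>] by (simp_all add: mult_ac)
    qed
    have Ds: "((\<lambda>x. sin (x - y1)) has_real_derivative cos (x - y1)) (at x)"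
       "((\<lambda>x. cos (x - y1)) has_real_derivative - 1 * sin (x - y1)) (at x)" for x
      by (auto intro!: derivative_eq_intros)
    have c: "isCont v y1" "isCont v' y1"
      unfolding v_def[abs_def] v'_def[abs_def]
      using f1(1) f2(1) by (auto intro!: isCont_mult DERIV_isCont[OF D(1)] DERIV_isCont[OF D(2)])
    have c': "(v \<longlongrightarrow> v y1) (at_right y1)" "(v' \<longlongrightarrow> v' y1) (at_right y1)"
      using c by (auto simp: isCont_def intro: tendsto_mono[OF at_le])
    have v1: "v y1 = 0" using f1(3) by (simp add: v_def)
    have "((\<lambda>x. v x * cos (x - y1) - v' x * sin (x - y1)) \<longlongrightarrow> v y1 * cos (y1 - y1) - v' y1 * sin (y1 - y1)) (at_right y1)"
      "((\<lambda>x. sin (x - y1) * v' x - cos (x - y1) * v x) \<longlongrightarrow> sin (y1 - y1) * v' y1 - cos (y1 - y1) * v y1) (at_right y1)"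
      by (intro tendsto_intros c' filterlim_ident)+
    then have lim: "((\<lambda>x. v x * cos (x - y1) - v' x * sin (x - y1)) \<longlongrightarrow> 0) (at_right y1)"
      "((\<lambda>x. sin (x - y1) * v' x - cos (x - y1) * v x) \<longlongrightarrow> 0) (at_right y1)"
      by (simp_all add: v1)
    consider "jacobi_A \<alpha> > 0" | "jacobi_A \<alpha> < 0" using A by linarith
    then have "sgn (pi - (y2 - y1)) = sgn (jacobi_A \<alpha>)"
    proof cases
      case 1
      have "y2 < y1 + pi"
      proof (rule ccontr)
        assume "\<not> y2 < y1 + pi"
        then have le: "y1 + pi \<le> y2" by simp
        have "sin (y1 + pi - y1) \<noteq> 0"
        proof (rule sturm_comparison[of y1 "y1 + pi" v v' "scaled_potential \<alpha> \<beta> n"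
              "\<lambda>x. sin (x - y1)" "\<lambda>x. cos (x - y1)" "\<lambda>_. 1" 0])
          fix x assume x: "y1 < x" "x < y1 + pi"
          then have "0 < x" using f1(1) by simp
          then have "4 * jacobi_A \<alpha> + potential_excess \<alpha> \<beta> (x / g) > 0" using small[of x] x y1 1 by auto
          then show "1 < scaled_potential \<alpha> \<beta> n x" using \<open>0 < x\<close> by (simp add: scaled_potential_def g_def)
          show "0 < sin (x - y1)" using x by (intro sin_gt_zero) auto
          show "0 < v x" unfolding v_def using x le by (intro \<sigma>) auto
        qed (use Dv Ds lim le in auto)
        then show False by simp
      qed
      with 1 show ?thesis by simp
    next
      case 2
      have "y1 + pi < y2"
      proof (rule ccontr)
        assume "\<not> y1 + pi < y2"
        then have le: "y2 \<le> y1 + pi" by simp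
        have "v y2 \<noteq> 0"
        proof (rule sturm_comparison[of y1 y2 "\<lambda>x. sin (x - y1)" "\<lambda>x. cos (x - y1)" "\<lambda>_. 1"
              v v' "scaled_potential \<alpha> \<beta> n" 0])
          fix x assume x: "y1 < x" "x < y2"
          then have "0 < x" using f1(1) by simp
          then have "4 * jacobi_A \<alpha> + potential_excess \<alpha> \<beta> (x / g) < 0" using small[of x] x y1 2 le by auto
          then show "scaled_potential \<alpha> \<beta> n x < 1"
            using \<open>0 < x\<close> by (simp add: scaled_potential_def g_def divide_neg_pos)
          show "0 < sin (x - y1)" using x le by (intro sin_gt_zero) auto
          show "0 < v x" unfolding v_def using x by (intro \<sigma>) auto
        qed (use Dv Ds lim f2(1) in auto)
        then show False using f2(3) by (simp add: v_def)
      qed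
      with 2 show ?thesis by simp
    qed
    then show "sgn (pi - (scaled_zero \<alpha> \<beta> n Y 2 - scaled_zero \<alpha> \<beta> n Y 1)) = sgn (jacobi_A \<alpha>)"
      by (simp add: y1_def y2_def)
  qed
qed

section \<open>Signs at both ends of the spectrum of zeros\<close>

theorem proposition2p4:
  fixes \<alpha> \<beta> :: real
  assumes "(\<alpha>, \<beta>) \<in> jacobi_U"
  shows "\<exists>N. \<forall>n\<ge>N.
           sgn (jacobi_Delta \<alpha> \<beta> n 1) = sgn (jacobi_C \<alpha> \<beta>) \<and>
           sgn (jacobi_Delta \<alpha> \<beta> n n) = sgn (jacobi_B \<beta>) \<and>
           jacobi_Delta \<alpha> \<beta> n 1 * jacobi_Delta \<alpha> \<beta> n n < 0"
proof -
  have a: "\<alpha> > - 1" "\<beta> > - 1" and BC: "jacobi_B \<beta> * jacobi_C \<alpha> \<beta> < 0"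
    using assms by (auto simp: jacobi_U_def)
  have AB: "jacobi_A x = jacobi_B x" for x by (simp add: jacobi_A_def jacobi_B_def)
  have nz: "jacobi_C \<alpha> \<beta> \<noteq> 0" "jacobi_A \<beta> \<noteq> 0" using BC by (auto simp: AB)
  \<comment> \<open>\<open>BC < 0\<close> forces \<open>A\<close> to have the sign opposite to \<open>B\<close>, with \<open>\<bar>A\<bar> > 3 \<bar>B\<bar>\<close>.\<close>
  have C': "sgn (jacobi_C \<beta> \<alpha>) = - sgn (jacobi_B \<beta>)"
    using BC by (auto simp: jacobi_C_def AB mult_less_0_iff sgn_if)
  then have "jacobi_C \<beta> \<alpha> \<noteq> 0" using nz by (auto simp: AB sgn_if split: if_splits)
  have "\<forall>n. \<exists>Y. jacobi_solution \<alpha> \<beta> n Y \<and> (\<forall>x. poly (jacobi_poly \<alpha> \<beta> n) x = poly Y ((1 - x) / 2))"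
    using jacobi_solution_exists[OF a] by metis
  then obtain Y where Y: "\<And>n. jacobi_solution \<alpha> \<beta> n (Y n)"
    and jp: "\<And>n x. poly (jacobi_poly \<alpha> \<beta> n) x = poly (Y n) ((1 - x) / 2)" by metis
  have theta: "jacobi_theta \<alpha> \<beta> n k = zero_angle (Y n) k" for n k
    by (rule jacobi_theta_eq_zero_angle[OF jp])
  have Y1: "poly (Y n) 1 \<noteq> 0" for n
    using jacobi_poly_minus_one_nonzero[OF a, of n] by (simp add: jp)
  define R where "R n = smult (sgn (poly (Y n) 1)) (pcompose (Y n) [:1, -1:])" for n
  have R: "jacobi_solution \<beta> \<alpha> n (R n)" for n
    unfolding R_def by (rule jacobi_solution_reflect[OF Y Y1])
  have refl: "zero_angle (R n) k = pi - zero_angle (Y n) (n + 1 - k)" if "1 \<le> k" "k \<le> n" for n k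
    unfolding R_def using Y1 by (intro zero_angle_reflect[OF Y _ that]) (simp add: sgn_zero_iff)
  have gam: "jacobi_gamma \<beta> \<alpha> n = jacobi_gamma \<alpha> \<beta> n" for n
    by (simp add: jacobi_gamma_def jacobi_rho_def add_ac)
  obtain N1 where N1: "\<And>n Y Z. n \<ge> N1 \<Longrightarrow> jacobi_solution \<alpha> \<beta> n Y \<Longrightarrow> jacobi_solution \<alpha> \<beta> (n + 1) Z \<Longrightarrow>
       sgn (scaled_zero \<alpha> \<beta> (n + 1) Z 1 - scaled_zero \<alpha> \<beta> n Y 1) = sgn (jacobi_C \<alpha> \<beta>)"
    using sgn_scaled_first_zero_diff[OF a nz(1)] by metis
  obtain N2 where N2: "\<And>n Y Z. n \<ge> N2 \<Longrightarrow> jacobi_solution \<beta> \<alpha> n Y \<Longrightarrow> jacobi_solution \<beta> \<alpha> (n + 1) Z \<Longrightarrow>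
       sgn (scaled_zero \<beta> \<alpha> (n + 1) Z 1 - scaled_zero \<beta> \<alpha> n Y 1) = sgn (jacobi_C \<beta> \<alpha>)"
    using sgn_scaled_first_zero_diff[OF a(2,1) \<open>jacobi_C \<beta> \<alpha> \<noteq> 0\<close>] by metis
  obtain N3 where N3: "\<And>n Y. n \<ge> N3 \<Longrightarrow> jacobi_solution \<beta> \<alpha> n Y \<Longrightarrow>
       sgn (pi - (scaled_zero \<beta> \<alpha> n Y 2 - scaled_zero \<beta> \<alpha> n Y 1)) = sgn (jacobi_A \<beta>)"
    using sgn_pi_minus_scaled_zero_gap[OF a(2,1) nz(2)] by metis
  show ?thesis
  proof (intro exI[of _ "max 1 (max N1 (max N2 N3))"] allI impI)
    fix n assume n: "max 1 (max N1 (max N2 N3)) \<le> n"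
    have first: "sgn (jacobi_Delta \<alpha> \<beta> n 1) = sgn (jacobi_C \<alpha> \<beta>)"
      using N1[OF _ Y[of n] Y[of "n + 1"]] n by (simp add: jacobi_Delta_def scaled_zero_def theta)
    define s where "s k m = scaled_zero \<beta> \<alpha> m (R m) k" for k m
    \<comment> \<open>The largest zero of degree \<open>n\<close> reflects to the first one, the \<open>n\<close>-th zero of degree \<open>n + 1\<close> to the second one.\<close>
    have "jacobi_Delta \<alpha> \<beta> n n = (pi - (s 2 (n + 1) - s 1 (n + 1))) + (s 1 n - s 1 (n + 1))"
    proof -
      have e1: "zero_angle (Y (n + 1)) n = pi - zero_angle (R (n + 1)) 2" using refl[of 2 "n + 1"] n by simp
      have e2: "zero_angle (Y n) n = pi - zero_angle (R n) 1" using refl[of 1 n] n by simp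
      have e3: "jacobi_gamma \<alpha> \<beta> (n + 1) = jacobi_gamma \<alpha> \<beta> n + 1" by (simp add: jacobi_gamma_def)
      show ?thesis
        unfolding jacobi_Delta_def theta s_def scaled_zero_def gam e1 e2 e3 by (simp add: algebra_simps)
    qed
    moreover have "sgn (pi - (s 2 (n + 1) - s 1 (n + 1))) = sgn (jacobi_B \<beta>)"
      using N3[OF _ R[of "n + 1"]] n by (simp add: s_def AB)
    moreover have "sgn (s 1 (n + 1) - s 1 n) = - sgn (jacobi_B \<beta>)"
      using N2[OF _ R[of n] R[of "n + 1"]] n by (simp add: s_def C')
    ultimately have last: "sgn (jacobi_Delta \<alpha> \<beta> n n) = sgn (jacobi_B \<beta>)"
      by (auto simp: sgn_if split: if_splits)
    have "sgn (jacobi_Delta \<alpha> \<beta> n 1 * jacobi_Delta \<alpha> \<beta> n n) = sgn (jacobi_B \<beta> * jacobi_C \<alpha> \<beta>)"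
      by (simp only: sgn_mult first last mult.commute)
    then have "jacobi_Delta \<alpha> \<beta> n 1 * jacobi_Delta \<alpha> \<beta> n n < 0"
      using BC by (metis sgn_less)
    with first last show "sgn (jacobi_Delta \<alpha> \<beta> n 1) = sgn (jacobi_C \<alpha> \<beta>) \<and>
           sgn (jacobi_Delta \<alpha> \<beta> n n) = sgn (jacobi_B \<beta>) \<and>
           jacobi_Delta \<alpha> \<beta> n 1 * jacobi_Delta \<alpha> \<beta> n n < 0" by blast
  qed
qed

end
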